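(* There exists an infinite family of metric spaces $\{(V_\ell,d_{V_\ell})\}$ and terminal sequences $\{\sigma_\ell\}$ (with $\sigma_\ell$ a sequence of points of $V_\ell$) such that every probabilistic online embedding of $\sigma_\ell$ into HSTs has expected distortion at least $$\Omega\left(\frac{\log k\cdot\log\Phi_\ell}{\log\log k}\right),$$ where $k=|\sigma_\ell|$ and $\Phi_\ell$ is the aspect ratio of $(V_\ell,d_{V_\ell})$; moreover $\Phi_\ell$ can be as large as $2^{k^{1-\delta}}$ for any fixed $\delta\in(0,1)$.
   Context: An online embedding of a sequence of points $x_1,\ldots,x_k$ of a metric space $(V,d_V)$ into a metric space $(M,d_M)$ is a sequence of maps $f_1,\ldots,f_k$ such that for each $i$: (1) $f_i$ is a non-contractive embedding of $\{x_1,\ldots,x_i\}$ into $M$; (2) $f_i$ extends $f_{i-1}$. Its distortion is the distortion of $f_k$. A probabilistic online embedding is a probability distribution over online embeddings; its expected distortion is $\max_{u\neq v}E[d_M(f_k(u),f_k(v))]/d_V(u,v)$. An HST ($\mu$-HST for some $\mu>1$) metric is the metric on the leaves of a rooted tree in which each node $v$ has a label $\Delta(v)\ge0$, with $\Delta(v)=0$ iff $v$ is a leaf, and $\Delta(v)\le\Delta(u)/\mu$ whenever $v$ is a child of $u$; the distance between two leaves is the label of their least common ancestor. The aspect ratio of a finite metric space is the ratio of its maximum to its minimum nonzero pairwise distance.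
   Formalization: For a fixed terminal sequence the bound is false (FRT gives O(log k)), so the terminal sequence may depend on the probabilistic online embedding, taken as a distribution over online strategies valid on every sequence of distinct points of the metric space; the constant may depend on δ. *)

theory Defs
  imports "HOL-Probability.Probability"
begin

definition finite_metric_space :: "nat set \<Rightarrow> (nat \<Rightarrow> nat \<Rightarrow> real) \<Rightarrow> bool" where
  "finite_metric_space V d \<longleftrightarrow> finite V \<and>
     (\<forall>x\<in>V. \<forall>y\<in>V. d x y \<ge> 0 \<and> (d x y = 0 \<longleftrightarrow> x = y) \<and> d x y = d y x) \<and>
     (\<forall>x\<in>V. \<forall>y\<in>V. \<forall>z\<in>V. d x z \<le> d x y + d y z)"

definition nonzero_dists :: "nat set \<Rightarrow> (nat \<Rightarrow> nat \<Rightarrow> real) \<Rightarrow> real set" where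
  "nonzero_dists V d = {d x y | x y. x \<in> V \<and> y \<in> V \<and> x \<noteq> y}"

definition aspect_ratio :: "nat set \<Rightarrow> (nat \<Rightarrow> nat \<Rightarrow> real) \<Rightarrow> real" where
  "aspect_ratio V d = Max (nonzero_dists V d) / Min (nonzero_dists V d)"

text \<open>A rooted labelled tree on nodes of type nat: (node set, root, parent map, label).
  The parent of the root is the root itself; every node reaches the root by
  finitely many parent steps.\<close>
type_synonym hst = "nat set \<times> nat \<times> (nat \<Rightarrow> nat) \<times> (nat \<Rightarrow> real)"

definition hst_nodes :: "hst \<Rightarrow> nat set" where "hst_nodes T = fst T"
definition hst_root :: "hst \<Rightarrow> nat" where "hst_root T = fst (snd T)"
definition hst_parent :: "hst \<Rightarrow> nat \<Rightarrow> nat" where "hst_parent T = fst (snd (snd T))"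
definition hst_label :: "hst \<Rightarrow> nat \<Rightarrow> real" where "hst_label T = snd (snd (snd T))"

definition ancestors :: "hst \<Rightarrow> nat \<Rightarrow> nat set" where
  "ancestors T v = {(hst_parent T ^^ n) v | n. True}"

definition is_leaf :: "hst \<Rightarrow> nat \<Rightarrow> bool" where
  "is_leaf T v \<longleftrightarrow> v \<in> hst_nodes T \<and>
     \<not> (\<exists>w\<in>hst_nodes T. w \<noteq> hst_root T \<and> hst_parent T w = v)"

definition is_rooted_tree :: "hst \<Rightarrow> bool" where
  "is_rooted_tree T \<longleftrightarrow> hst_root T \<in> hst_nodes T \<and> hst_parent T (hst_root T) = hst_root T \<and>
     (\<forall>v\<in>hst_nodes T. v \<noteq> hst_root T \<longrightarrow> hst_parent T v \<in> hst_nodes T) \<and>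
     (\<forall>v\<in>hst_nodes T. \<exists>n. (hst_parent T ^^ n) v = hst_root T)"

definition is_hst :: "hst \<Rightarrow> bool" where
  "is_hst T \<longleftrightarrow> is_rooted_tree T \<and>
     (\<forall>v\<in>hst_nodes T. hst_label T v \<ge> 0 \<and> (hst_label T v = 0 \<longleftrightarrow> is_leaf T v)) \<and>
     (\<exists>\<mu>::real. \<mu> > 1 \<and> (\<forall>v\<in>hst_nodes T. v \<noteq> hst_root T \<longrightarrow>
          hst_label T v \<le> hst_label T (hst_parent T v) / \<mu>))"

definition lca :: "hst \<Rightarrow> nat \<Rightarrow> nat \<Rightarrow> nat" where
  "lca T u v = (THE w. w \<in> ancestors T u \<inter> ancestors T v \<and>
                  (\<forall>w'\<in>ancestors T u \<inter> ancestors T v. w' \<in> ancestors T w))"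

definition hst_dist :: "hst \<Rightarrow> nat \<Rightarrow> nat \<Rightarrow> real" where
  "hst_dist T u v = hst_label T (lca T u v)"

text \<open>A deterministic online embedding strategy: a target HST together with a map that,
  given the prefix x_1..x_i of the input sequence, returns the image of x_i.  Hence f_i
  depends only on x_1..x_i and f_i extends f_(i-1).\<close>
type_synonym online_alg = "hst \<times> (nat list \<Rightarrow> nat)"

definition emb_img :: "online_alg \<Rightarrow> nat list \<Rightarrow> nat \<Rightarrow> nat" where
  "emb_img A xs i = snd A (take (Suc i) xs)"

definition valid_online_hst_alg :: "nat set \<Rightarrow> (nat \<Rightarrow> nat \<Rightarrow> real) \<Rightarrow> online_alg \<Rightarrow> bool" where
  "valid_online_hst_alg V d A \<longleftrightarrow> is_hst (fst A) \<and>
     (\<forall>xs. distinct xs \<and> set xs \<subseteq> V \<longrightarrow>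
        (\<forall>i<length xs. is_leaf (fst A) (emb_img A xs i)) \<and>
        (\<forall>i<length xs. \<forall>j<length xs.
            d (xs ! i) (xs ! j) \<le> hst_dist (fst A) (emb_img A xs i) (emb_img A xs j)))"

text \<open>A probabilistic online embedding into HSTs: a probability distribution over
  deterministic online strategies (randomness fixed in advance, oblivious adversary).\<close>
definition prob_online_hst_embedding ::
  "nat set \<Rightarrow> (nat \<Rightarrow> nat \<Rightarrow> real) \<Rightarrow> online_alg measure \<Rightarrow> bool" where
  "prob_online_hst_embedding V d P \<longleftrightarrow> prob_space P \<and>
     (\<forall>A\<in>space P. valid_online_hst_alg V d A) \<and>
     (\<forall>xs i j. (\<lambda>A. hst_dist (fst A) (emb_img A xs i) (emb_img A xs j)) \<in> borel_measurable P)"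

definition expected_distortion ::
  "online_alg measure \<Rightarrow> (nat \<Rightarrow> nat \<Rightarrow> real) \<Rightarrow> nat list \<Rightarrow> ennreal" where
  "expected_distortion P d xs =
     (SUP ij \<in> {(i, j). i < length xs \<and> j < length xs \<and> xs ! i \<noteq> xs ! j}.
        (\<integral>\<^sup>+ A. ennreal (hst_dist (fst A) (emb_img A xs (fst ij)) (emb_img A xs (snd ij))) \<partial>P)
          / ennreal (d (xs ! fst ij) (xs ! snd ij)))"

end

theory Submission
  imports Defs
begin

text \<open>Given a pair \<open>u, v\<close> at distance \<open>n w\<close>, present a layered gadget whose layers are copies of the
  Hamming cube of dimension \<open>n\<close>, the outermost ones collapsed to \<open>u\<close> and \<open>v\<close>, and whose edges flip one
  bit and have length \<open>w\<close>. The paths \<open>x, x \<oplus> e_j, x, \<dots>\<close> partition the edges, and on each path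
  an ultrametric stretches some edge at least as much as the pair \<open>u, v\<close>: the average distortion of an
  edge is at least that of \<open>u, v\<close>. Moreover a cluster of diameter less than \<open>n w / 4\<close> contains few
  edges, so a constant fraction of all edges gets stretched by \<open>n / 4\<close>, and the average distortion
  grows by \<open>\<Omega>(n)\<close>. Recursing on an edge that the given distribution stretches at least that much
  in expectation, \<open>L\<close> levels give distortion \<open>\<Omega>(n L)\<close> with \<open>k \<approx> L n 2^n\<close> points and aspect ratio
  \<open>n^L\<close>; choosing \<open>L\<close> exponential in \<open>n\<close> yields the bound. All gadgets live inside one integer box
  with the sup metric.\<close>

section \<open>HST metrics are ultrametrics\<close>

lemma ancestors_trans: "a \<in> ancestors T b \<Longrightarrow> b \<in> ancestors T c \<Longrightarrow> a \<in> ancestors T c"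
proof -
  assume "a \<in> ancestors T b" "b \<in> ancestors T c"
  then obtain m n where "a = (hst_parent T ^^ m) b" "b = (hst_parent T ^^ n) c"
    by (auto simp: ancestors_def)
  then have "a = (hst_parent T ^^ (m + n)) c" by (simp add: funpow_add)
  then show ?thesis by (auto simp: ancestors_def)
qed

lemma ancestors_linear:
  assumes "a \<in> ancestors T v" "b \<in> ancestors T v"
  shows "a \<in> ancestors T b \<or> b \<in> ancestors T a"
proof -
  obtain m n where mn: "a = (hst_parent T ^^ m) v" "b = (hst_parent T ^^ n) v"
    using assms by (auto simp: ancestors_def)
  have "m = (m - n) + n" if "n \<le> m" using that by simp
  moreover have "n = (n - m) + m" if "m \<le> n" using that by simp
  ultimately have "a = (hst_parent T ^^ (m - n)) b \<or> b = (hst_parent T ^^ (n - m)) a"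
    using mn by (metis funpow_add comp_apply nat_le_linear)
  then show ?thesis by (auto simp: ancestors_def)
qed

lemma ancestors_in_nodes:
  assumes "is_rooted_tree T" "v \<in> hst_nodes T" "a \<in> ancestors T v"
  shows "a \<in> hst_nodes T"
proof -
  have "(hst_parent T ^^ n) v \<in> hst_nodes T" for n
  proof (induction n)
    case (Suc n)
    then show ?case using assms(1) by (cases "(hst_parent T ^^ n) v = hst_root T")
        (auto simp: is_rooted_tree_def)
  qed (use assms in simp)
  then show ?thesis using assms(3) by (auto simp: ancestors_def)
qed

lemma funpow_parent_root:
  assumes "is_rooted_tree T"
  shows "(hst_parent T ^^ n) (hst_root T) = hst_root T"
  using assms by (induction n) (auto simp: is_rooted_tree_def)

lemma root_in_ancestors:
  assumes "is_rooted_tree T" "v \<in> hst_nodes T"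
  shows "hst_root T \<in> ancestors T v"
proof -
  obtain n where "(hst_parent T ^^ n) v = hst_root T" using assms by (auto simp: is_rooted_tree_def)
  then show ?thesis unfolding ancestors_def by (metis (mono_tags, lifting) mem_Collect_eq)
qed

text \<open>Mutual ancestry puts \<open>a\<close> on a cycle of parent steps. Enough rounds pass the
  root, which is a fixed point of the parent map, so the cycle is the root alone.\<close>

lemma ancestors_antisym:
  assumes T: "is_rooted_tree T" and a: "a \<in> hst_nodes T"
    and "a \<in> ancestors T b" "b \<in> ancestors T a"
  shows "a = b"
proof -
  let ?p = "hst_parent T"
  obtain m n where mn: "a = (?p ^^ m) b" "b = (?p ^^ n) a"
    using assms by (auto simp: ancestors_def)
  have cyc: "(?p ^^ (m + n)) a = a" using mn by (metis funpow_add comp_apply)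
  show ?thesis
  proof (cases "m + n = 0")
    case False
    obtain q where q: "(?p ^^ q) a = hst_root T" using T a by (auto simp: is_rooted_tree_def)
    have "(?p ^^ (j * (m + n))) a = a" for j
      by (induction j) (use cyc in \<open>simp_all add: funpow_add\<close>)
    moreover have "q * (m + n) = (q * (m + n) - q) + q" using False by (cases "m + n") auto
    ultimately have "a = (?p ^^ (q * (m + n) - q)) ((?p ^^ q) a)" by (metis funpow_add comp_apply)
    then have "a = hst_root T" using q funpow_parent_root[OF T] by metis
    then show ?thesis using mn(2) funpow_parent_root[OF T] by metis
  next
    case True
    then show ?thesis using mn(1) by simp
  qed
qed

text \<open>The first ancestor of \<open>u\<close> that is also an ancestor of \<open>v\<close> has
  all common ancestors above it. Antisymmetry makes it unique, so the definite description in
  \<open>lca\<close> denotes it.\<close>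

lemma lca_common_ancestor:
  assumes T: "is_rooted_tree T" and u: "u \<in> hst_nodes T" and v: "v \<in> hst_nodes T"
  shows "lca T u v \<in> ancestors T u" "lca T u v \<in> ancestors T v"
    and "w \<in> ancestors T u \<Longrightarrow> w \<in> ancestors T v \<Longrightarrow> w \<in> ancestors T (lca T u v)"
proof -
  let ?p = "hst_parent T"
  let ?Q = "\<lambda>w. w \<in> ancestors T u \<inter> ancestors T v \<and>
                  (\<forall>w'\<in>ancestors T u \<inter> ancestors T v. w' \<in> ancestors T w)"
  let ?R = "\<lambda>n. (?p ^^ n) u \<in> ancestors T v"
  define n where "n = (LEAST n. ?R n)"
  obtain m where "(?p ^^ m) u = hst_root T" using T u by (auto simp: is_rooted_tree_def)
  then have "?R m" using root_in_ancestors[OF T v] by simp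
  then have n: "?R n" unfolding n_def by (rule LeastI)
  have ex: "?Q ((?p ^^ n) u)"
  proof (intro conjI ballI)
    show "(?p ^^ n) u \<in> ancestors T u \<inter> ancestors T v" using n by (auto simp: ancestors_def)
    fix w' assume w': "w' \<in> ancestors T u \<inter> ancestors T v"
    then obtain m where m: "w' = (?p ^^ m) u" by (auto simp: ancestors_def)
    then have "n \<le> m" unfolding n_def using w' by (auto intro: Least_le)
    then have "w' = (?p ^^ (m - n)) ((?p ^^ n) u)" using m
      by (metis funpow_add comp_apply le_add_diff_inverse2)
    then show "w' \<in> ancestors T ((?p ^^ n) u)" by (auto simp: ancestors_def)
  qed
  have "\<exists>!w. ?Q w"
  proof (rule ex1I[where a = "(?p ^^ n) u"])
    show "?Q ((?p ^^ n) u)" by (rule ex)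
    fix w assume w: "?Q w"
    show "w = (?p ^^ n) u"
    proof (rule ancestors_antisym[OF T])
      show "w \<in> hst_nodes T" using w ancestors_in_nodes[OF T u] by blast
    qed (use w ex in blast)+
  qed
  then have "?Q (lca T u v)" unfolding lca_def by (rule theI')
  then show "lca T u v \<in> ancestors T u" "lca T u v \<in> ancestors T v"
    and "w \<in> ancestors T u \<Longrightarrow> w \<in> ancestors T v \<Longrightarrow> w \<in> ancestors T (lca T u v)" by auto
qed

lemma label_ancestor_mono:
  assumes T: "is_hst T" and v: "v \<in> hst_nodes T" and "a \<in> ancestors T v"
  shows "hst_label T v \<le> hst_label T a"
proof -
  have tree: "is_rooted_tree T" using T by (simp add: is_hst_def)
  obtain \<mu> :: real where mu: "\<mu> > 1" "\<And>v. v \<in> hst_nodes T \<Longrightarrow> v \<noteq> hst_root T \<Longrightarrow>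
          hst_label T v \<le> hst_label T (hst_parent T v) / \<mu>"
    using T by (auto simp: is_hst_def)
  have step: "hst_label T w \<le> hst_label T (hst_parent T w)" if w: "w \<in> hst_nodes T" for w
  proof (cases "w = hst_root T")
    case False
    then have "hst_parent T w \<in> hst_nodes T" using tree w by (auto simp: is_rooted_tree_def)
    then have "hst_label T (hst_parent T w) \<ge> 0" using T by (auto simp: is_hst_def)
    then have "hst_label T (hst_parent T w) / \<mu> \<le> hst_label T (hst_parent T w)"
      using mu(1) by (simp add: divide_le_eq mult_le_cancel_left1)
    then show ?thesis using mu(2)[OF w False] by simp
  qed (use tree in \<open>simp add: is_rooted_tree_def\<close>)
  have "hst_label T v \<le> hst_label T ((hst_parent T ^^ n) v)" for n
  proof (induction n)
    case (Suc n)
    have "(hst_parent T ^^ n) v \<in> hst_nodes T"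
      by (rule ancestors_in_nodes[OF tree v]) (auto simp: ancestors_def)
    then show ?case using Suc step by force
  qed simp
  then show ?thesis using assms(3) by (auto simp: ancestors_def)
qed

lemma hst_dist_sym: "hst_dist T u v = hst_dist T v u"
  by (simp add: hst_dist_def lca_def Int_commute)

text \<open>\<open>lca T u v\<close> and \<open>lca T v w\<close> are both ancestors of
  \<open>v\<close>, hence comparable. The upper one is a common ancestor of \<open>u\<close> and
  \<open>w\<close>, and labels do not decrease upwards.\<close>

lemma hst_dist_ultrametric:
  assumes T: "is_hst T" and u: "u \<in> hst_nodes T" and v: "v \<in> hst_nodes T" and w: "w \<in> hst_nodes T"
  shows "hst_dist T u w \<le> max (hst_dist T u v) (hst_dist T v w)"
proof -
  have tree: "is_rooted_tree T" using T by (simp add: is_hst_def)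
  note lca = lca_common_ancestor[OF tree]
  have le: "hst_dist T u w \<le> hst_label T a" if "a \<in> ancestors T u" "a \<in> ancestors T w" for a
    unfolding hst_dist_def
    using label_ancestor_mono[OF T] lca[OF u w] ancestors_in_nodes[OF tree u] that by blast
  have "lca T u v \<in> ancestors T (lca T v w) \<or> lca T v w \<in> ancestors T (lca T u v)"
    using ancestors_linear lca(2)[OF u v] lca(1)[OF v w] by blast
  then show ?thesis
  proof
    assume "lca T u v \<in> ancestors T (lca T v w)"
    then have "lca T u v \<in> ancestors T w" using lca(2)[OF v w] ancestors_trans by blast
    then show ?thesis using le[of "lca T u v"] lca(1)[OF u v] by (simp add: hst_dist_def le_max_iff_disj)
  next
    assume "lca T v w \<in> ancestors T (lca T u v)"
    then have "lca T v w \<in> ancestors T u" using lca(1)[OF u v] ancestors_trans by blast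
    then show ?thesis using le[of "lca T v w"] lca(2)[OF v w] by (simp add: hst_dist_def le_max_iff_disj)
  qed
qed

section \<open>Average stretch of a gadget in an ultrametric\<close>

definition flip :: "nat \<Rightarrow> nat set \<Rightarrow> nat set" where
  "flip j x = (if j \<in> x then x - {j} else insert j x)"

definition ham :: "nat \<Rightarrow> nat set \<Rightarrow> nat set \<Rightarrow> nat" where
  "ham n x y = card {j \<in> {..<n}. (j \<in> x) \<noteq> (j \<in> y)}"

lemma flip_flip [simp]: "flip j (flip j x) = x"
  by (auto simp: flip_def)

lemma mem_flip: "i \<in> flip j x \<longleftrightarrow> (if i = j then i \<notin> x else i \<in> x)"
  by (auto simp: flip_def)

lemma flip_subset: "x \<subseteq> {..<n} \<Longrightarrow> j < n \<Longrightarrow> flip j x \<subseteq> {..<n}"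
  by (auto simp: flip_def)

lemma bij_betw_flip: "j < n \<Longrightarrow> bij_betw (flip j) (Pow {..<n}) (Pow {..<n})"
  by (rule bij_betw_byWitness[where f' = "flip j"]) (auto simp: flip_def)

lemma ham_self [simp]: "ham n x x = 0"
  by (simp add: ham_def)

lemma ham_pos: "x \<subseteq> {..<n} \<Longrightarrow> y \<subseteq> {..<n} \<Longrightarrow> x \<noteq> y \<Longrightarrow> 0 < ham n x y"
  by (auto simp: ham_def card_gt_0_iff)

lemma ham_flip: "\<bar>int (ham n z (flip j x)) - int (ham n z x)\<bar> \<le> 1"
proof -
  have le: "ham n z (flip j x) \<le> Suc (ham n z x)" for x
  proof -
    have "ham n z (flip j x) \<le> card (insert j {i \<in> {..<n}. (i \<in> z) \<noteq> (i \<in> x)})"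
      unfolding ham_def by (rule card_mono) (auto simp: mem_flip split: if_splits)
    also have "\<dots> \<le> Suc (ham n z x)" unfolding ham_def by (rule card_insert_le_m1) simp_all
    finally show ?thesis .
  qed
  show ?thesis using le[of x] le[of "flip j x"] by simp
qed

text \<open>Meant for the alternating paths through a gadget, whose ends are the collapsed layers
  \<open>u\<close> and \<open>v\<close>.\<close>

lemma ultrametric_path:
  fixes \<tau> :: "'a \<Rightarrow> 'a \<Rightarrow> real"
  assumes ultra: "\<And>p q t. p \<in> S \<Longrightarrow> q \<in> S \<Longrightarrow> t \<in> S \<Longrightarrow> \<tau> p t \<le> max (\<tau> p q) (\<tau> q t)"
    and c: "\<And>i. i \<le> s \<Longrightarrow> c i \<in> S" and "0 < s"
  shows "\<exists>i<s. \<tau> (c 0) (c s) \<le> \<tau> (c i) (c (Suc i))"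
  using c \<open>0 < s\<close>
proof (induction s)
  case (Suc s)
  show ?case
  proof (cases "s = 0")
    case False
    with Suc have "\<exists>i<s. \<tau> (c 0) (c s) \<le> \<tau> (c i) (c (Suc i))" by simp
    then obtain i where i: "i < s" "\<tau> (c 0) (c s) \<le> \<tau> (c i) (c (Suc i))" by blast
    have "\<tau> (c 0) (c (Suc s)) \<le> max (\<tau> (c 0) (c s)) (\<tau> (c s) (c (Suc s)))"
      by (rule ultra) (use Suc.prems in simp_all)
    then have "\<tau> (c 0) (c (Suc s)) \<le> \<tau> (c 0) (c s) \<or> \<tau> (c 0) (c (Suc s)) \<le> \<tau> (c s) (c (Suc s))"
      by (simp add: le_max_iff_disj)
    then show ?thesis using i by (meson less_Suc_eq order.trans)
  qed auto
qed simp

text \<open>If \<open>a\<close> is a common centre of the cluster, an edge in direction \<open>j\<close> has exactly one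
  endpoint that disagrees with \<open>a\<close> in \<open>j\<close>; each vertex near its centre is charged fewer than
  \<open>r\<close> times.\<close>
lemma card_edges_within_clusters:
  fixes f g :: "nat set \<Rightarrow> nat set"
  assumes E: "\<And>x j. (x, j) \<in> E \<Longrightarrow> x \<subseteq> {..<n} \<and> j < n \<and> f x = g (flip j x)
     \<and> ham n x (f x) < r \<and> ham n (flip j x) (g (flip j x)) < r"
  shows "card E \<le> 2 * r * 2 ^ n"
proof -
  let ?X = "Pow {..<n}"
  \<comment> \<open>\<open>D h x\<close> holds the directions charged to \<open>x\<close>: the bits
    where \<open>x\<close> disagrees with its centre \<open>h x\<close>. It is empty for a distant
    centre, so it has at most \<open>r\<close> elements.\<close>
  define D where "D h x = (if ham n x (h x) < r then {j \<in> {..<n}. (j \<in> x) \<noteq> (j \<in> h x)} else {})"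
    for h :: "nat set \<Rightarrow> nat set" and x
  have card: "card (Sigma ?X (D h)) \<le> r * 2 ^ n" for h
  proof -
    have "card (Sigma ?X (D h)) = (\<Sum>x\<in>?X. card (D h x))"
      by (rule card_SigmaI) (auto simp: D_def)
    also have "\<dots> \<le> (\<Sum>x\<in>?X. r)" by (rule sum_mono) (auto simp: D_def ham_def)
    finally show ?thesis by (simp add: card_Pow mult.commute)
  qed
  have fin: "finite (Sigma ?X (D h))" for h by (rule finite_SigmaI) (auto simp: D_def)
  \<comment> \<open>An edge charged to its second endpoint \<open>y\<close> is recovered by flipping
    bit \<open>j\<close> of \<open>y\<close> back.\<close>
  have "E \<subseteq> Sigma ?X (D f) \<union> (\<lambda>(y, j). (flip j y, j)) ` Sigma ?X (D g)"
  proof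
    fix e assume e: "e \<in> E"
    obtain x j where xj: "e = (x, j)" by (cases e)
    note * = E[OF e[unfolded xj]]
    show "e \<in> Sigma ?X (D f) \<union> (\<lambda>(y, j). (flip j y, j)) ` Sigma ?X (D g)"
    proof (cases "(j \<in> x) \<noteq> (j \<in> f x)")
      case True
      then show ?thesis using * xj by (auto simp: D_def)
    next
      case False
      then have "(flip j x, j) \<in> Sigma ?X (D g)"
        using * by (auto simp: D_def mem_flip flip_subset)
      then have "(\<lambda>(y, j). (flip j y, j)) (flip j x, j) \<in> (\<lambda>(y, j). (flip j y, j)) ` Sigma ?X (D g)"
        by (rule imageI)
      then show ?thesis using xj by simp
    qed
  qed
  then have "card E \<le> card (Sigma ?X (D f) \<union> (\<lambda>(y, j). (flip j y, j)) ` Sigma ?X (D g))"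
    by (rule card_mono[rotated]) (use fin in simp)
  also have "\<dots> \<le> card (Sigma ?X (D f)) + card (Sigma ?X (D g))"
    by (rule order.trans[OF card_Un_le]) (simp add: card_image_le fin)
  also have "\<dots> \<le> 2 * r * 2 ^ n" using card[of f] card[of g] by simp
  finally show ?thesis .
qed

text \<open>For fixed \<open>i\<close> and \<open>j\<close> the map \<open>flip j\<close> permutes
  the cube, so odd layers can be reindexed. This regroups the edges of a gadget into the paths
  alternating between \<open>x\<close> and \<open>flip j x\<close>.\<close>

lemma sum_flip_paths:
  fixes h :: "nat \<Rightarrow> nat set \<Rightarrow> nat \<Rightarrow> real"
  shows "(\<Sum>i<s. \<Sum>x\<in>Pow {..<n}. \<Sum>j<n. h i x j) =
    (\<Sum>x\<in>Pow {..<n}. \<Sum>j<n. \<Sum>i<s. h i (if even i then x else flip j x) j)"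
proof -
  let ?X = "Pow {..<n}" and ?c = "\<lambda>i x j. if even i then x else flip j x"
  have shift: "(\<Sum>x\<in>?X. h i x j) = (\<Sum>x\<in>?X. h i (?c i x j) j)" if "j < n" for i j
    using sum.reindex_bij_betw[OF bij_betw_flip[OF that], of "\<lambda>x. h i x j"] by (cases "even i") simp_all
  have "(\<Sum>i<s. \<Sum>x\<in>?X. \<Sum>j<n. h i x j) = (\<Sum>i<s. \<Sum>j<n. \<Sum>x\<in>?X. h i x j)"
    by (intro sum.cong refl sum.swap)
  also have "\<dots> = (\<Sum>i<s. \<Sum>j<n. \<Sum>x\<in>?X. h i (?c i x j) j)"
    by (rule sum.cong[OF refl], rule sum.cong[OF refl], rule shift, simp)
  also have "\<dots> = (\<Sum>i<s. \<Sum>x\<in>?X. \<Sum>j<n. h i (?c i x j) j)"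
    by (rule sum.cong[OF refl], rule sum.swap)
  also have "\<dots> = (\<Sum>x\<in>?X. \<Sum>i<s. \<Sum>j<n. h i (?c i x j) j)"
    by (rule sum.swap)
  also have "\<dots> = (\<Sum>x\<in>?X. \<Sum>j<n. \<Sum>i<s. h i (?c i x j) j)"
    by (rule sum.cong[OF refl], rule sum.swap)
  finally show ?thesis .
qed

text \<open>Call an edge long if its stretch is at least \<open>w * r\<close>. Deducting
  \<open>w * r\<close> from every long edge still leaves \<open>t - w * r\<close> on each of the
  \<open>n * 2 ^ n\<close> paths, and at least \<open>4 * r^2 * 2 ^ n\<close> edges are long. Adding
  the deductions back is a net gain of \<open>(4 * r^2 - n) * 2 ^ n\<close> times
  \<open>w * r\<close>.\<close>

lemma gadget_sum_ge:
  fixes \<tau> :: "nat \<times> nat set \<Rightarrow> nat \<times> nat set \<Rightarrow> real" and r :: nat and w t :: real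
  defines "n \<equiv> 4 * r"
  defines "S \<equiv> {..n} \<times> Pow {..<n}"
  assumes r: "0 < r" and w: "0 < w" and t: "w * r \<le> t"
    and nonneg: "\<And>p q. p \<in> S \<Longrightarrow> q \<in> S \<Longrightarrow> 0 \<le> \<tau> p q"
    and sym: "\<And>p q. \<tau> p q = \<tau> q p"
    and ultra: "\<And>p q t. p \<in> S \<Longrightarrow> q \<in> S \<Longrightarrow> t \<in> S \<Longrightarrow> \<tau> p t \<le> max (\<tau> p q) (\<tau> q t)"
    and ends: "\<And>x y. x \<subseteq> {..<n} \<Longrightarrow> y \<subseteq> {..<n} \<Longrightarrow> t \<le> \<tau> (0, x) (n, y)"
    and far: "\<And>i j x y. (i, x) \<in> S \<Longrightarrow> (j, y) \<in> S \<Longrightarrow>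
        w * real (min (ham n x y) (min j (n - j))) \<le> \<tau> (i, x) (j, y)"
  shows "2 ^ n * real n * t + 2 ^ n * (4 * real r ^ 2 * (real r - 1)) * w
     \<le> (\<Sum>i<n. \<Sum>x\<in>Pow {..<n}. \<Sum>j<n. \<tau> (i, x) (Suc i, flip j x))"
proof -
  let ?X = "Pow {..<n}"
  define R where "R = w * real r"
  define \<epsilon> where "\<epsilon> i x j = \<tau> (i, x) (Suc i, flip j x)" for i x j
  define b where "b i x j = (if R \<le> \<epsilon> i x j then 1 else 0 :: real)" for i x j
  have R: "0 < R" using r w by (simp add: R_def)
  \<comment> \<open>By \<open>ultrametric_path\<close> some edge of the path is stretched by at
    least \<open>t\<close>. The other terms stay nonnegative, since \<open>R\<close> is deducted
    only where the stretch reaches \<open>R\<close>.\<close>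
  have path: "t - R \<le> (\<Sum>i<n. \<epsilon> i (if even i then x else flip j x) j
       - R * b i (if even i then x else flip j x) j)" if x: "x \<in> ?X" and j: "j < n" for x j
  proof -
    define c where "c i = (i, if even i then x else flip j x)" for i :: nat
    have cS: "c i \<in> S" if "i \<le> n" for i
      using that x j flip_subset[of x n j] by (auto simp: c_def S_def)
    have \<epsilon>c: "\<epsilon> i (if even i then x else flip j x) j = \<tau> (c i) (c (Suc i))" for i
      by (simp add: \<epsilon>_def c_def)
    define h where "h i = \<epsilon> i (if even i then x else flip j x) j
       - R * b i (if even i then x else flip j x) j" for i
    obtain i0 where i0: "i0 < n" "\<tau> (c 0) (c n) \<le> \<tau> (c i0) (c (Suc i0))"
      using ultrametric_path[of S \<tau> n c, OF ultra] cS r by (auto simp: n_def)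
    have "t \<le> \<tau> (c 0) (c n)" unfolding c_def using ends x j flip_subset[of x n j] by auto
    then have "t - R \<le> h i0" using i0 R by (simp add: h_def b_def \<epsilon>c)
    moreover have h0: "0 \<le> h i" if "i < n" for i
      using nonneg[OF cS[of i] cS[of "Suc i"]] that by (auto simp: h_def b_def \<epsilon>c)
    moreover have "h i0 \<le> (\<Sum>i<n. h i)"
      by (rule member_le_sum) (use i0 h0 in auto)
    ultimately show ?thesis unfolding h_def by linarith
  qed
  have "(\<Sum>x\<in>?X. \<Sum>j<n. t - R) \<le> (\<Sum>x\<in>?X. \<Sum>j<n. \<Sum>i<n. \<epsilon> i (if even i then x else flip j x) j
       - R * b i (if even i then x else flip j x) j)"
    by (intro sum_mono path) auto
  also have "\<dots> = (\<Sum>i<n. \<Sum>x\<in>?X. \<Sum>j<n. \<epsilon> i x j - R * b i x j)"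
    by (rule sum_flip_paths[symmetric])
  also have "\<dots> = (\<Sum>i<n. \<Sum>x\<in>?X. \<Sum>j<n. \<epsilon> i x j) - R * (\<Sum>i<n. \<Sum>x\<in>?X. \<Sum>j<n. b i x j)"
    by (simp add: sum_subtractf sum_distrib_left)
  finally have main: "2 ^ n * real n * (t - R) + R * (\<Sum>i<n. \<Sum>x\<in>?X. \<Sum>j<n. b i x j)
      \<le> (\<Sum>i<n. \<Sum>x\<in>?X. \<Sum>j<n. \<epsilon> i x j)"
    by (simp add: card_Pow)
  \<comment> \<open>In the layers \<open>r\<close> to \<open>3 * r\<close> the truncation
    \<open>min j (n - j)\<close> is at least \<open>r\<close>, so by \<open>far\<close> points
    closer than \<open>R\<close> have Hamming distance below \<open>r\<close>.\<close>
  define M where "M = {r..3 * r} \<times> ?X"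
  have MS: "M \<subseteq> S" using r by (auto simp: M_def S_def n_def)
  \<comment> \<open>Closeness below \<open>R\<close> is symmetric and transitive in an ultrametric.
    Hence close points satisfy the same choice predicate and receive the same centre.\<close>
  define rep where "rep p = snd (SOME q. q \<in> M \<and> \<tau> p q < R)" for p
  have rep_eq: "rep p = rep q" if "p \<in> M" "q \<in> M" "\<tau> p q < R" for p q
  proof -
    have "\<tau> p o' < R \<longleftrightarrow> \<tau> q o' < R" if "o' \<in> M" for o'
    proof -
      have S: "p \<in> S" "q \<in> S" "o' \<in> S" using that MS \<open>p \<in> M\<close> \<open>q \<in> M\<close> by auto
      show ?thesis using ultra[OF S] ultra[OF S(2,1,3)] \<open>\<tau> p q < R\<close> sym[of q p] by auto
    qed
    then have "(\<lambda>o'. o' \<in> M \<and> \<tau> p o' < R) = (\<lambda>o'. o' \<in> M \<and> \<tau> q o' < R)" by blast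
    then show ?thesis unfolding rep_def by simp
  qed
  have rep_near: "ham n x (rep (i, x)) < r" if p: "(i, x) \<in> M" and q: "q \<in> M" "\<tau> (i, x) q < R" for i x q
  proof -
    obtain j a where ja: "(SOME q. q \<in> M \<and> \<tau> (i, x) q < R) = (j, a)" by (cases "SOME q. q \<in> M \<and> \<tau> (i, x) q < R")
    \<comment> \<open>The choice is meaningful because of \<open>q\<close>, which will be the other
      end of a short edge.\<close>
    have "(j, a) \<in> M \<and> \<tau> (i, x) (j, a) < R"
      unfolding ja[symmetric] by (rule someI_ex) (use q in blast)
    then have *: "(j, a) \<in> M" "\<tau> (i, x) (j, a) < R" by auto
    then have "w * real (min (ham n x a) (min j (n - j))) < w * real r"
      using far[of i x j a] MS p unfolding R_def by (meson order.strict_trans1 subsetD)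
    then have "min (ham n x a) (min j (n - j)) < r" using w by simp
    moreover have "r \<le> min j (n - j)" using * by (auto simp: M_def n_def)
    ultimately show ?thesis by (auto simp: rep_def ja min_less_iff_disj)
  qed
  \<comment> \<open>For \<open>i < 3 * r\<close> both layers \<open>i\<close> and
    \<open>Suc i\<close> belong to \<open>M\<close>. Clusters contain at most
    \<open>2 * r * 2 ^ n\<close> of the \<open>4 * r * 2 ^ n\<close> edges, so at least half are
    long.\<close>
  have layer: "2 ^ n * (2 * real r) \<le> (\<Sum>x\<in>?X. \<Sum>j<n. b i x j)" if i: "i \<in> {r..<3 * r}" for i
  proof -
    define E where "E = {(x, j). x \<in> ?X \<and> j < n \<and> \<epsilon> i x j < R}"
    have cE: "card E \<le> 2 * r * 2 ^ n"
    proof (rule card_edges_within_clusters[where f = "\<lambda>x. rep (i, x)" and g = "\<lambda>x. rep (Suc i, x)"])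
      fix x j assume xj: "(x, j) \<in> E"
      then have j: "j < n" and x: "x \<subseteq> {..<n}" and \<tau>: "\<tau> (i, x) (Suc i, flip j x) < R"
        by (auto simp: E_def \<epsilon>_def)
      have p: "(i, x) \<in> M" "(Suc i, flip j x) \<in> M" using i x j flip_subset[OF x j] by (auto simp: M_def)
      have \<tau>': "\<tau> (Suc i, flip j x) (i, x) < R" using \<tau> sym[of "(i, x)"] by simp
      show "x \<subseteq> {..<n} \<and> j < n \<and> rep (i, x) = rep (Suc i, flip j x) \<and> ham n x (rep (i, x)) < r
         \<and> ham n (flip j x) (rep (Suc i, flip j x)) < r"
        using x j rep_eq[OF p \<tau>] rep_near[OF p \<tau>] rep_near[OF p(2,1) \<tau>'] by simp
    qed
    have "E \<subseteq> ?X \<times> {..<n}" by (auto simp: E_def)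
    have "(\<Sum>x\<in>?X. \<Sum>j<n. b i x j) = (\<Sum>e\<in>?X \<times> {..<n}. 1 - indicator E e)"
      unfolding sum.cartesian_product
      by (rule sum.cong) (auto simp: b_def E_def indicator_def split: if_splits)
    also have "\<dots> = 2 ^ n * real n - card E"
    proof -
      have "(\<Sum>e\<in>?X \<times> {..<n}. indicator E e) = (card E :: real)"
        using \<open>E \<subseteq> _\<close> by (simp add: indicator_def sum.If_cases Int_absorb1)
      then show ?thesis by (simp add: sum_subtractf card_Pow card_cartesian_product)
    qed
    finally have "(\<Sum>x\<in>?X. \<Sum>j<n. b i x j) = 2 ^ n * real n - card E" .
    moreover have "real (card E) \<le> 2 * real r * 2 ^ n"
      using of_nat_mono[OF cE, where 'a = real] by simp
    ultimately show ?thesis by (simp add: n_def algebra_simps)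
  qed
  have "2 ^ n * (4 * real r ^ 2) = (\<Sum>i\<in>{r..<3 * r}. 2 ^ n * (2 * real r))"
    by (simp add: power2_eq_square)
  also have "\<dots> \<le> (\<Sum>i\<in>{r..<3 * r}. \<Sum>x\<in>?X. \<Sum>j<n. b i x j)" by (intro sum_mono layer)
  also have "\<dots> \<le> (\<Sum>i<n. \<Sum>x\<in>?X. \<Sum>j<n. b i x j)"
    by (rule sum_mono2) (auto simp: n_def b_def intro!: sum_nonneg)
  finally have "R * (2 ^ n * (4 * real r ^ 2)) \<le> R * (\<Sum>i<n. \<Sum>x\<in>?X. \<Sum>j<n. b i x j)"
    using R by simp
  moreover have "R * (2 ^ n * (4 * real r ^ 2)) - 2 ^ n * real n * R
      = 2 ^ n * (4 * real r ^ 2 * (real r - 1)) * w"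
    by (simp add: R_def n_def algebra_simps power2_eq_square)
  ultimately show ?thesis using main unfolding \<epsilon>_def by (simp add: algebra_simps)
qed

section \<open>Gadgets in the sup metric\<close>

definition sup_dist :: "'i set \<Rightarrow> ('i \<Rightarrow> int) \<Rightarrow> ('i \<Rightarrow> int) \<Rightarrow> int" where
  "sup_dist I f g = Max ((\<lambda>z. \<bar>f z - g z\<bar>) ` I)"

text \<open>The value 0 outside \<open>I\<close> makes the box finite and lets
  \<open>sup_dist I\<close> separate its points.\<close>

definition box :: "'i set \<Rightarrow> int \<Rightarrow> ('i \<Rightarrow> int) set" where
  "box I M = {f. \<forall>z. (z \<in> I \<longrightarrow> f z \<in> {0..M}) \<and> (z \<notin> I \<longrightarrow> f z = 0)}"

lemma boxD:
  assumes "f \<in> box I M"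
  shows "z \<in> I \<Longrightarrow> 0 \<le> f z \<and> f z \<le> M" "z \<notin> I \<Longrightarrow> f z = 0"
  using assms by (simp_all add: box_def)

lemma finite_box: "finite I \<Longrightarrow> finite (box I M)"
  unfolding box_def by (rule finite_set_of_finite_funs) simp_all

lemma sup_dist_ge: "finite I \<Longrightarrow> z \<in> I \<Longrightarrow> \<bar>f z - g z\<bar> \<le> sup_dist I f g"
  unfolding sup_dist_def by (rule Max_ge) auto

lemma sup_dist_le_iff:
  "finite I \<Longrightarrow> I \<noteq> {} \<Longrightarrow> sup_dist I f g \<le> c \<longleftrightarrow> (\<forall>z\<in>I. \<bar>f z - g z\<bar> \<le> c)"
  unfolding sup_dist_def by (subst Max_le_iff) auto

lemma sup_dist_sym: "sup_dist I f g = sup_dist I g f"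
  by (simp add: sup_dist_def abs_minus_commute)

lemma sup_dist_nonneg: "finite I \<Longrightarrow> I \<noteq> {} \<Longrightarrow> 0 \<le> sup_dist I f g"
  using sup_dist_ge by (metis abs_ge_zero equals0I order.trans)

lemma sup_dist_triangle:
  assumes "finite I" "I \<noteq> {}"
  shows "sup_dist I f h \<le> sup_dist I f g + sup_dist I g h"
  unfolding sup_dist_le_iff[OF assms]
proof
  fix z assume "z \<in> I"
  then show "\<bar>f z - h z\<bar> \<le> sup_dist I f g + sup_dist I g h"
    using sup_dist_ge[OF assms(1), of z f g] sup_dist_ge[OF assms(1), of z g h] by linarith
qed

lemma sup_dist_eq_0_iff:
  assumes "finite I" "I \<noteq> {}" "f \<in> box I M" "g \<in> box I M"
  shows "sup_dist I f g = 0 \<longleftrightarrow> f = g"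
proof
  assume "sup_dist I f g = 0"
  then have "\<forall>z\<in>I. f z = g z" using sup_dist_le_iff[OF assms(1,2), of f g 0] by simp
  then show "f = g" using assms(3,4) unfolding box_def fun_eq_iff by force
next
  assume "f = g"
  then show "sup_dist I f g = 0"
    using sup_dist_le_iff[OF assms(1,2), of f g 0] sup_dist_nonneg[OF assms(1,2), of f g] by simp
qed

lemma sup_dist_le_box:
  assumes "finite I" "I \<noteq> {}" "f \<in> box I M" "g \<in> box I M"
  shows "sup_dist I f g \<le> M"
  unfolding sup_dist_le_iff[OF assms(1,2)] using assms(3,4) by (fastforce simp: box_def)

text \<open>Block 0 contains the base coordinate \<open>(0, {})\<close>; block \<open>Suc l\<close>
  is reserved for the gadget of level \<open>l\<close>, with one coordinate per cube vertex.\<close>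

definition coords :: "nat \<Rightarrow> nat \<Rightarrow> (nat \<times> nat set) set" where
  "coords n L = {..L} \<times> Pow {..<n}"

lemma coords: "finite (coords n L)" "(0, {}) \<in> coords n L" "coords n L \<noteq> {}"
  by (auto simp: coords_def)

text \<open>The gadget between \<open>u\<close> and \<open>v\<close> interpolates linearly in all used coordinates, while the
  fresh block \<open>Suc l\<close> of coordinates is a Frechet embedding of the Hamming cube, truncated so that
  layer \<open>0\<close> collapses to \<open>u\<close> and layer \<open>n\<close> to \<open>v\<close>.\<close>
definition gadget_point ::
  "nat \<Rightarrow> nat \<Rightarrow> int \<Rightarrow> (nat \<times> nat set \<Rightarrow> int) \<Rightarrow> (nat \<times> nat set \<Rightarrow> int) \<Rightarrow> nat \<times> nat set \<Rightarrow> nat \<times> nat set \<Rightarrow> int"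
where
  "gadget_point n l w u v p z = u z + int (fst p) * w * sgn (v z - u z) +
     (if fst z = Suc l \<and> snd z \<subseteq> {..<n}
      then w * int (min (ham n (snd z) (snd p)) (min (fst p) (n - fst p))) else 0)"

text \<open>The invariants of the recursion. Coordinate differences 0 or
  \<open>\<plusminus> n w\<close> let steps of size \<open>w\<close> lead from \<open>u\<close> to
  \<open>v\<close> in exactly \<open>n\<close> layers. The base coordinate reveals the layer, and
  the blocks after \<open>l\<close> are still zero.\<close>

locale gadget =
  fixes n l L :: nat and w M :: int and u v :: "nat \<times> nat set \<Rightarrow> int"
  assumes u: "u \<in> box (coords n L) M" and v: "v \<in> box (coords n L) M"
    and l: "l < L" and w: "0 < w" and n: "0 < n" and M: "int n * w \<le> M"
    and diff: "\<And>z. v z - u z \<in> {0, int n * w, - (int n * w)}"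
    and base: "v (0, {}) - u (0, {}) = int n * w"
    and fresh: "\<And>z. l < fst z \<Longrightarrow> u z = 0 \<and> v z = 0"
begin

abbreviation "\<gamma> \<equiv> gadget_point n l w u v"

lemma v_eq: "v z = u z + int n * w * sgn (v z - u z)"
proof -
  have "e = int n * w * sgn e" if "e \<in> {0, int n * w, - (int n * w)}" for e
    using that w n by (auto simp: sgn_mult)
  from this[OF diff[of z]] show ?thesis by simp
qed

lemma first: "\<gamma> (0, x) = u"
  by (auto simp: gadget_point_def)

lemma last: "\<gamma> (n, x) = v"
  using v_eq by (auto simp: gadget_point_def fun_eq_iff)

lemma in_box:
  assumes i: "i \<le> n"
  shows "\<gamma> (i, x) \<in> box (coords n L) M"
  unfolding box_def
proof (intro CollectI allI conjI impI)
  fix z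
  have uz: "z \<in> coords n L \<Longrightarrow> 0 \<le> u z \<and> u z \<le> M \<and> 0 \<le> v z \<and> v z \<le> M"
    and out: "z \<notin> coords n L \<Longrightarrow> u z = 0 \<and> v z = 0"
    using u v by (auto dest: boxD)
  show "\<gamma> (i, x) z = 0" if "z \<notin> coords n L"
    using out[OF that] that l by (cases z) (auto simp: gadget_point_def coords_def)
  assume z: "z \<in> coords n L"
  have iw: "0 \<le> int i * w" "int i * w \<le> int n * w" using i w by auto
  show "\<gamma> (i, x) z \<in> {0..M}"
  proof (cases "fst z = Suc l")
    case True
    define m where "m = w * int (min (ham n (snd z) x) (min i (n - i)))"
    have "m \<le> w * int n" unfolding m_def using w i by (intro mult_left_mono) auto
    then have "m \<le> M" using M by (simp add: mult.commute)
    moreover have "0 \<le> m" using w by (simp add: m_def)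
    moreover have "\<gamma> (i, x) z = (if snd z \<subseteq> {..<n} then m else 0)"
      using fresh[of z] True by (simp add: gadget_point_def m_def)
    ultimately show ?thesis by auto
  next
    \<comment> \<open>Outside the fresh block the value lies between \<open>u z\<close> and
      \<open>v z\<close>, because \<open>i \<le> n\<close>.\<close>
    case False
    have "sgn (v z - u z) = 0 \<or> sgn (v z - u z) = 1 \<or> sgn (v z - u z) = -1"
      by (auto simp: sgn_if)
    then show ?thesis using False uz[OF z] iw v_eq[of z] by (auto simp: gadget_point_def)
  qed
qed

text \<open>An edge satisfies the invariant of the pair with \<open>w\<close> in place of
  \<open>n * w\<close>, so it can be the next pair. In the fresh block the Hamming distance and the
  layer number both change by at most one, hence so does their truncated minimum.\<close>

lemma step:
  assumes i: "i < n"
  shows "\<gamma> (Suc i, flip j x) z - \<gamma> (i, x) z \<in> {0, w, - w}"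
    and "\<gamma> (Suc i, flip j x) (0, {}) - \<gamma> (i, x) (0, {}) = w"
proof -
  show "\<gamma> (Suc i, flip j x) (0, {}) - \<gamma> (i, x) (0, {}) = w"
    using base w n by (simp add: gadget_point_def algebra_simps)
  show "\<gamma> (Suc i, flip j x) z - \<gamma> (i, x) z \<in> {0, w, - w}"
  proof (cases "fst z = Suc l \<and> snd z \<subseteq> {..<n}")
    case True
    define a where "a = int (min (ham n (snd z) (flip j x)) (min (Suc i) (n - Suc i)))
      - int (min (ham n (snd z) x) (min i (n - i)))"
    have "\<bar>a\<bar> \<le> 1" using ham_flip[of n "snd z" j x] i unfolding a_def by (auto simp: min_def)
    then have "a = 0 \<or> a = 1 \<or> a = -1" by auto
    moreover have "\<gamma> (Suc i, flip j x) z - \<gamma> (i, x) z = w * a"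
      using True fresh[of z] by (simp add: gadget_point_def a_def algebra_simps)
    ultimately show ?thesis by auto
  next
    case False
    then have "\<gamma> (Suc i, flip j x) z - \<gamma> (i, x) z = w * sgn (v z - u z)"
      by (auto simp: gadget_point_def algebra_simps)
    then show ?thesis by (auto simp: sgn_if)
  qed
qed

lemma later: "Suc l < fst z \<Longrightarrow> \<gamma> p z = 0"
  using fresh[of z] by (simp add: gadget_point_def)

lemma fresh_coordinate:
  assumes "x \<subseteq> {..<n}"
  shows "\<gamma> (j, y) (Suc l, x) = w * int (min (ham n x y) (min j (n - j)))"
  using fresh[of "(Suc l, x)"] assms by (simp add: gadget_point_def)

text \<open>The coordinate labelled \<open>x\<close> of the fresh block vanishes at
  \<open>(i, x)\<close> and shows the truncated distance at \<open>(j, y)\<close>.\<close>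

lemma far:
  assumes "x \<subseteq> {..<n}"
  shows "w * int (min (ham n x y) (min j (n - j))) \<le> sup_dist (coords n L) (\<gamma> (i, x)) (\<gamma> (j, y))"
proof -
  have "(Suc l, x) \<in> coords n L" using l assms by (auto simp: coords_def)
  from sup_dist_ge[OF coords(1) this, of "\<gamma> (i, x)" "\<gamma> (j, y)"]
  show ?thesis using w fresh_coordinate[OF assms] by simp
qed

text \<open>The base coordinate determines the layer. Within an inner layer, the fresh coordinate
  labelled \<open>x\<close> vanishes at \<open>x\<close> only.\<close>

lemma inj: "inj_on \<gamma> ({1..<n} \<times> Pow {..<n})"
proof (rule inj_onI, clarify)
  fix i x j y assume *: "i \<in> {1..<n}" "j \<in> {1..<n}" "x \<subseteq> {..<n}" "y \<subseteq> {..<n}" "\<gamma> (i, x) = \<gamma> (j, y)"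
  have "\<gamma> (i, x) (0, {}) = \<gamma> (j, y) (0, {})" using * by simp
  then have "i = j" using base w n by (simp add: gadget_point_def)
  moreover have "x = y"
  proof (rule ccontr)
    assume "x \<noteq> y"
    then have "0 < min (ham n x y) (min j (n - j))" using ham_pos[of x n y] * by auto
    then have "0 < \<gamma> (j, y) (Suc l, x)" unfolding fresh_coordinate[OF \<open>x \<subseteq> _\<close>] using w by simp
    moreover have "\<gamma> (i, x) (Suc l, x) = 0" unfolding fresh_coordinate[OF \<open>x \<subseteq> _\<close>] by simp
    ultimately show False using * by simp
  qed
  ultimately show "i = j \<and> x = y" by simp
qed

text \<open>Separates inner gadget points from all earlier points, which vanish beyond block
  \<open>l\<close>. The witness is the coordinate labelled by the neighbour \<open>flip 0 x\<close>
  of \<open>x\<close>, at positive Hamming distance.\<close>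

lemma new:
  assumes "i \<in> {1..<n}" "x \<subseteq> {..<n}"
  shows "\<exists>z. l < fst z \<and> \<gamma> (i, x) z \<noteq> 0"
proof (intro exI conjI)
  have x': "flip 0 x \<subseteq> {..<n}" using assms n by (intro flip_subset) auto
  have "flip 0 x \<noteq> x" using mem_flip[of 0 0 x] by metis
  then have "0 < ham n (flip 0 x) x" using ham_pos[OF x' assms(2)] by simp
  then show "\<gamma> (i, x) (Suc l, flip 0 x) \<noteq> 0" unfolding fresh_coordinate[OF x'] using w assms by simp
qed simp

end

section \<open>One step of the adversary\<close>

text \<open>Indexes images by points instead of positions: the strategy is applied to the prefix
  ending at the first occurrence of \<open>p\<close>. Hence appending further points leaves earlier
  images unchanged.\<close>

definition emb :: "online_alg \<Rightarrow> nat list \<Rightarrow> nat \<Rightarrow> nat" where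
  "emb A xs p = snd A (takeWhile (\<lambda>q. q \<noteq> p) xs @ [p])"

lemma emb_nth:
  assumes "distinct xs" "i < length xs"
  shows "emb A xs (xs ! i) = emb_img A xs i"
proof -
  have "takeWhile (\<lambda>q. q \<noteq> xs ! i) xs = take i xs"
    by (rule takeWhile_eq_take_P_nth) (use assms in \<open>auto simp: nth_eq_iff_index_eq\<close>)
  then show ?thesis using assms by (simp add: emb_def emb_img_def take_Suc_conv_app_nth)
qed

lemma emb_append: "p \<in> set xs \<Longrightarrow> emb A (xs @ ys) p = emb A xs p"
  by (simp add: emb_def takeWhile_append1)

definition expected_dist :: "online_alg measure \<Rightarrow> nat list \<Rightarrow> nat \<Rightarrow> nat \<Rightarrow> ennreal" where
  "expected_dist P xs p q = (\<integral>\<^sup>+ A. ennreal (hst_dist (fst A) (emb A xs p) (emb A xs q)) \<partial>P)"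

lemma expected_dist_append:
  "p \<in> set xs \<Longrightarrow> q \<in> set xs \<Longrightarrow> expected_dist P (xs @ ys) p q = expected_dist P xs p q"
  by (simp add: expected_dist_def emb_append)

lemma expected_distortion_ge:
  assumes "distinct xs" "p \<in> set xs" "q \<in> set xs" "p \<noteq> q"
  shows "expected_dist P xs p q / ennreal (d p q) \<le> expected_distortion P d xs"
proof -
  obtain i j where ij: "i < length xs" "xs ! i = p" "j < length xs" "xs ! j = q"
    using assms(2,3) by (auto simp: in_set_conv_nth)
  show ?thesis unfolding expected_distortion_def
    by (rule SUP_upper2[where i = "(i, j)"])
      (use ij assms emb_nth[OF assms(1) ij(1)] emb_nth[OF assms(1) ij(3)] in \<open>auto simp: expected_dist_def\<close>)
qed

lemma measurable_hst_dist:
  assumes P: "prob_online_hst_embedding V d P" and "distinct xs" "p \<in> set xs" "q \<in> set xs"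
  shows "(\<lambda>A. hst_dist (fst A) (emb A xs p) (emb A xs q)) \<in> borel_measurable P"
proof -
  obtain i j where ij: "i < length xs" "xs ! i = p" "j < length xs" "xs ! j = q"
    using assms(3,4) by (auto simp: in_set_conv_nth)
  then have "(\<lambda>A. hst_dist (fst A) (emb A xs p) (emb A xs q))
      = (\<lambda>A. hst_dist (fst A) (emb_img A xs i) (emb_img A xs j))"
    using emb_nth[OF assms(2)] by force
  then show ?thesis using P by (simp add: prob_online_hst_embedding_def)
qed

lemma hst_dist_emb:
  assumes A: "valid_online_hst_alg V d A" and xs: "distinct xs" "set xs \<subseteq> V"
  shows "p \<in> set xs \<Longrightarrow> q \<in> set xs \<Longrightarrow> d p q \<le> hst_dist (fst A) (emb A xs p) (emb A xs q)"
    and "p \<in> set xs \<Longrightarrow> q \<in> set xs \<Longrightarrow> t \<in> set xs \<Longrightarrow> hst_dist (fst A) (emb A xs p) (emb A xs t)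
      \<le> max (hst_dist (fst A) (emb A xs p) (emb A xs q)) (hst_dist (fst A) (emb A xs q) (emb A xs t))"
proof -
  have hst: "is_hst (fst A)" using A by (simp add: valid_online_hst_alg_def)
  have *: "is_leaf (fst A) (emb_img A xs i)"
      "d (xs ! i) (xs ! j) \<le> hst_dist (fst A) (emb_img A xs i) (emb_img A xs j)"
    if "i < length xs" "j < length xs" for i j
    using A xs that by (auto simp: valid_online_hst_alg_def)
  have node: "emb A xs p \<in> hst_nodes (fst A)" if "p \<in> set xs" for p
    using that emb_nth[OF xs(1), of _ A] * unfolding is_leaf_def in_set_conv_nth by metis
  show "d p q \<le> hst_dist (fst A) (emb A xs p) (emb A xs q)" if "p \<in> set xs" "q \<in> set xs"
    using that emb_nth[OF xs(1), of _ A] *(2) unfolding in_set_conv_nth by metis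
  show "hst_dist (fst A) (emb A xs p) (emb A xs t)
      \<le> max (hst_dist (fst A) (emb A xs p) (emb A xs q)) (hst_dist (fst A) (emb A xs q) (emb A xs t))"
    if "p \<in> set xs" "q \<in> set xs" "t \<in> set xs"
    by (rule hst_dist_ultrametric[OF hst]) (use that node in auto)
qed

text \<open>The largest term is at least the mean; the finite nonzero cardinality can be cancelled
  in \<open>ennreal\<close>.\<close>

lemma sum_ge_ex_term_ge:
  fixes f :: "'a \<Rightarrow> ennreal" and b :: real
  assumes E: "finite E" "E \<noteq> {}" and "ennreal (card E * b) \<le> sum f E"
  shows "\<exists>e\<in>E. ennreal b \<le> f e"
proof -
  obtain e where e: "e \<in> E" "f e = Max (f ` E)"
    using Max_in[of "f ` E"] E by (metis (no_types, lifting) finite_imageI imageE image_is_empty)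
  have "ennreal (card E) * ennreal b = ennreal (card E * b)"
    by (simp add: ennreal_mult')
  also have "\<dots> \<le> sum f E" by (rule assms)
  also have "\<dots> \<le> of_nat (card E) * f e"
    by (rule sum_bounded_above) (use e E in simp)
  finally have "ennreal (card E) * ennreal b \<le> ennreal (card E) * f e"
    by (simp add: ennreal_of_nat_eq_real_of_nat)
  then have "ennreal b \<le> f e" using E by (subst (asm) ennreal_mult_le_mult_iff) auto
  then show ?thesis using e by blast
qed

text \<open>\<open>gadget_sum_ge\<close> holds for each strategy with \<open>t\<close> its own
  stretch \<open>T A\<close> of the pair. The bound is affine in \<open>t\<close>, so it survives
  integration, and averaging over the edges yields a single edge good in expectation.\<close>

lemma online_gadget_step:
  fixes \<gamma> :: "nat \<times> nat set \<Rightarrow> nat" and r :: nat and w a :: real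
  defines "n \<equiv> 4 * r"
  defines "S \<equiv> {..n} \<times> Pow {..<n}"
  assumes P: "prob_online_hst_embedding V d P" and V: "finite_metric_space V d"
    and r: "0 < r" and w: "0 < w" and a: "0 \<le> a"
    and xs: "distinct xs" "set xs \<subseteq> V" and \<gamma>: "\<gamma> ` S \<subseteq> set xs"
    and ends: "\<And>x. x \<subseteq> {..<n} \<Longrightarrow> \<gamma> (0, x) = u \<and> \<gamma> (n, x) = v"
    and far: "\<And>i j x y. (i, x) \<in> S \<Longrightarrow> (j, y) \<in> S \<Longrightarrow>
        w * real (min (ham n x y) (min j (n - j))) \<le> d (\<gamma> (i, x)) (\<gamma> (j, y))"
    and duv: "w * real r \<le> d u v" and auv: "ennreal a \<le> expected_dist P xs u v"
  shows "\<exists>i<n. \<exists>x j. x \<subseteq> {..<n} \<and> j < n \<and>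
    ennreal (a / real n + w * (real r - 1) / 4) \<le> expected_dist P xs (\<gamma> (i, x)) (\<gamma> (Suc i, flip j x))"
proof -
  define C where "C = 2 ^ n * real n"
  define K where "K = 2 ^ n * (4 * real r ^ 2 * (real r - 1)) * w"
  define E where "E = {..<n} \<times> Pow {..<n} \<times> {..<n}"
  define \<tau> where "\<tau> A p q = hst_dist (fst A) (emb A xs (\<gamma> p)) (emb A xs (\<gamma> q))" for A p q
  define T where "T A = hst_dist (fst A) (emb A xs u) (emb A xs v)" for A
  have n: "0 < n" using r by (simp add: n_def)
  have K: "0 \<le> K" and C: "0 \<le> C" using r w by (auto simp: K_def C_def)
  interpret prob_space P using P by (simp add: prob_online_hst_embedding_def)
  have "(0, {}) \<in> S" "(n, {}) \<in> S" by (auto simp: S_def)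
  then have uv: "u \<in> set xs" "v \<in> set xs" using ends[of "{}"] \<gamma> by (metis empty_subsetI image_subset_iff)+
  have in_xs: "\<gamma> p \<in> set xs" if "p \<in> S" for p using \<gamma> that by auto
  have ES: "(i, x) \<in> S" "(Suc i, flip j x) \<in> S" if "(i, x, j) \<in> E" for i x j
    using that flip_subset[of x n j] by (auto simp: E_def S_def)
  have nonneg: "0 \<le> d p q" if "p \<in> set xs" "q \<in> set xs" for p q
    using V subsetD[OF xs(2)] that by (auto simp: finite_metric_space_def)
  have pointwise: "ennreal C * ennreal (T A) + ennreal K
      \<le> (\<Sum>(i, x, j)\<in>E. ennreal (\<tau> A (i, x) (Suc i, flip j x)))" if "A \<in> space P" for A
  proof -
    have A: "valid_online_hst_alg V d A" using P that unfolding prob_online_hst_embedding_def by blast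
    note emb = hst_dist_emb[OF A xs]
    have \<tau>0: "0 \<le> \<tau> A p q" if "p \<in> S" "q \<in> S" for p q
      using emb(1)[OF in_xs[OF that(1)] in_xs[OF that(2)]] nonneg[OF in_xs[OF that(1)] in_xs[OF that(2)]]
      unfolding \<tau>_def by linarith
    have T: "w * real r \<le> T A" using emb(1)[OF uv] duv unfolding T_def by linarith
    moreover have "0 \<le> w * real r" using w by simp
    ultimately have T0: "0 \<le> T A" by linarith
    have "C * T A + K \<le> (\<Sum>i<n. \<Sum>x\<in>Pow {..<n}. \<Sum>j<n. \<tau> A (i, x) (Suc i, flip j x))"
      unfolding C_def K_def n_def
    proof (rule gadget_sum_ge[OF r w T])
      fix p q t assume "p \<in> {..4 * r} \<times> Pow {..<4 * r}" "q \<in> {..4 * r} \<times> Pow {..<4 * r}"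
      then have pq: "p \<in> S" "q \<in> S" by (auto simp: S_def n_def)
      show "0 \<le> \<tau> A p q" by (rule \<tau>0[OF pq])
      assume "t \<in> {..4 * r} \<times> Pow {..<4 * r}"
      then have "t \<in> S" by (auto simp: S_def n_def)
      then show "\<tau> A p t \<le> max (\<tau> A p q) (\<tau> A q t)"
        unfolding \<tau>_def by (intro emb(2) in_xs pq)
    next
      show "\<tau> A p q = \<tau> A q p" for p q unfolding \<tau>_def by (rule hst_dist_sym)
    next
      show "T A \<le> \<tau> A (0, x) (4 * r, y)" if "x \<subseteq> {..<4 * r}" "y \<subseteq> {..<4 * r}" for x y
        using ends[of x] ends[of y] that unfolding T_def \<tau>_def n_def by simp
    next
      fix i j x y assume "(i, x) \<in> {..4 * r} \<times> Pow {..<4 * r}" "(j, y) \<in> {..4 * r} \<times> Pow {..<4 * r}"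
      then have pq: "(i, x) \<in> S" "(j, y) \<in> S" by (auto simp: S_def n_def)
      show "w * real (min (ham (4 * r) x y) (min j (4 * r - j))) \<le> \<tau> A (i, x) (j, y)"
        using far[OF pq] emb(1)[OF in_xs[OF pq(1)] in_xs[OF pq(2)]] unfolding \<tau>_def n_def by linarith
    qed
    also have "\<dots> = (\<Sum>(i, x, j)\<in>E. \<tau> A (i, x) (Suc i, flip j x))"
      unfolding E_def by (simp add: sum.cartesian_product)
    finally have "ennreal (C * T A + K) \<le> ennreal (\<Sum>(i, x, j)\<in>E. \<tau> A (i, x) (Suc i, flip j x))"
      by (rule ennreal_leI)
    also have "ennreal (\<Sum>(i, x, j)\<in>E. \<tau> A (i, x) (Suc i, flip j x))
       = (\<Sum>(i, x, j)\<in>E. ennreal (\<tau> A (i, x) (Suc i, flip j x)))"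
      by (subst sum_ennreal[symmetric]) (auto simp: split_beta intro!: \<tau>0 ES)
    finally show ?thesis using C K T0 by (simp add: ennreal_plus ennreal_mult)
  qed
  \<comment> \<open>With \<open>n^2 * 2 ^ n\<close> edges and \<open>n = 4 * r\<close>, the mean of
    \<open>C * a\<close> is \<open>a / n\<close> and that of \<open>K\<close> is
    \<open>w * (r - 1) / 4\<close>.\<close>
  have "ennreal (card E * (a / real n + w * (real r - 1) / 4)) = ennreal C * ennreal a + ennreal K"
  proof -
    have "card E = n * 2 ^ n * n" by (simp add: E_def card_cartesian_product card_Pow)
    then have "card E * (a / real n + w * (real r - 1) / 4) = C * a + K"
      using r by (simp add: C_def K_def n_def field_simps power2_eq_square)
    then show ?thesis using C K a by (simp add: ennreal_plus ennreal_mult)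
  qed
  also have "\<dots> \<le> ennreal C * expected_dist P xs u v + ennreal K"
    using auv by (intro add_right_mono mult_left_mono) auto
  also have "\<dots> = (\<integral>\<^sup>+ A. ennreal C * ennreal (T A) + ennreal K \<partial>P)"
    using measurable_hst_dist[OF P xs(1) uv]
    by (subst nn_integral_add)
      (auto simp: nn_integral_cmult expected_dist_def T_def emeasure_space_1)
  also have "\<dots> \<le> (\<integral>\<^sup>+ A. (\<Sum>(i, x, j)\<in>E. ennreal (\<tau> A (i, x) (Suc i, flip j x))) \<partial>P)"
    by (rule nn_integral_mono) (rule pointwise)
  also have "\<dots> = (\<Sum>(i, x, j)\<in>E. expected_dist P xs (\<gamma> (i, x)) (\<gamma> (Suc i, flip j x)))"
    unfolding expected_dist_def \<tau>_def[symmetric] split_beta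
  proof (rule nn_integral_sum)
    fix e assume "e \<in> E"
    then have e: "(fst e, fst (snd e), snd (snd e)) \<in> E" by simp
    show "(\<lambda>A. ennreal (\<tau> A (fst e, fst (snd e)) (Suc (fst e), flip (snd (snd e)) (fst (snd e)))))
        \<in> borel_measurable P"
      unfolding \<tau>_def
      by (rule measurable_compose[OF measurable_hst_dist[OF P xs(1)] measurable_ennreal])
        (rule in_xs, rule ES[OF e])+
  qed
  finally have "\<exists>e\<in>E. ennreal (a / real n + w * (real r - 1) / 4)
      \<le> (case e of (i, x, j) \<Rightarrow> expected_dist P xs (\<gamma> (i, x)) (\<gamma> (Suc i, flip j x)))"
    by (rule sum_ge_ex_term_ge[rotated 2]) (use n in \<open>auto simp: E_def\<close>)
  then show ?thesis by (auto simp: E_def)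
qed

section \<open>The recursive adversary\<close>

text \<open>\<open>h\<close> encodes the box of side \<open>n ^ L\<close> by natural numbers, the
  carrier type of the metric spaces; \<open>L\<close> is the number of levels.\<close>

locale hard_space =
  fixes r L :: nat and h :: "(nat \<times> nat set \<Rightarrow> int) \<Rightarrow> nat"
  assumes r: "0 < r" and L: "0 < L" and h: "inj_on h (box (coords (4 * r) L) (int (4 * r) ^ L))"
begin

abbreviation "n \<equiv> 4 * r"
abbreviation "I \<equiv> coords n L"
abbreviation "B \<equiv> box I (int n ^ L)"

lemma one_le_diameter: "1 \<le> int n ^ L"
  by (rule one_le_power) (use r in simp)

definition V :: "nat set" where "V = h ` B"

definition d :: "nat \<Rightarrow> nat \<Rightarrow> real" where
  "d a b = real_of_int (sup_dist I (inv_into B h a) (inv_into B h b))"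

lemma d_eq: "f \<in> B \<Longrightarrow> g \<in> B \<Longrightarrow> d (h f) (h g) = real_of_int (sup_dist I f g)"
  using h by (simp add: d_def)

lemma finite_metric_space: "finite_metric_space V d"
  unfolding finite_metric_space_def
proof (intro conjI ballI)
  show "finite V" unfolding V_def by (intro finite_imageI finite_box coords(1))
next
  fix x y assume "x \<in> V" "y \<in> V"
  then obtain f g where fg: "f \<in> B" "g \<in> B" "x = h f" "y = h g" by (auto simp: V_def)
  show "0 \<le> d x y" using sup_dist_nonneg[OF coords(1,3)] fg by (simp add: d_eq)
  show "(d x y = 0) = (x = y)"
    using sup_dist_eq_0_iff[OF coords(1,3) fg(1,2)] fg inj_on_eq_iff[OF h fg(1,2)] by (simp add: d_eq)
  show "d x y = d y x" using fg sup_dist_sym by (simp add: d_eq)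
  fix z assume "z \<in> V"
  then obtain k where k: "k \<in> B" "z = h k" by (auto simp: V_def)
  show "d x z \<le> d x y + d y z"
    using sup_dist_triangle[OF coords(1,3), of n L f k g] fg k by (simp add: d_eq)
qed

definition point :: "int \<Rightarrow> nat \<times> nat set \<Rightarrow> int" where
  "point a z = (if z = (0, {}) then a else 0)"

lemma point_in_B: "0 \<le> a \<Longrightarrow> a \<le> int n ^ L \<Longrightarrow> point a \<in> B"
  using coords(2)[of n L] by (auto simp: point_def box_def)

lemma sup_dist_point: "0 \<le> a \<Longrightarrow> sup_dist I (point a) (point 0) = a"
  using sup_dist_ge[OF coords(1,2), of "point a" "point 0"]
    sup_dist_le_iff[OF coords(1,3), of n L "point a" "point 0" a]
  by (intro antisym) (auto simp: point_def)

text \<open>Nonzero distances are integers between 1 and the side of the box. Points on the base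
  axis attain both extremes.\<close>

lemma aspect_ratio: "aspect_ratio V d = real n ^ L"
proof -
  note M = one_le_diameter
  have ex: "real_of_int a \<in> nonzero_dists V d" if a: "0 < a" "a \<le> int n ^ L" for a
  proof -
    have B: "point a \<in> B" "point 0 \<in> B" using point_in_B a M by auto
    have "point a \<noteq> point 0" using a by (auto simp: point_def fun_eq_iff)
    then have "h (point a) \<noteq> h (point 0)" using inj_on_eq_iff[OF h B] by simp
    moreover have "real_of_int a = d (h (point a)) (h (point 0))" using d_eq[OF B] sup_dist_point a by simp
    ultimately show ?thesis unfolding nonzero_dists_def V_def using B by blast
  qed
  have fin: "finite (nonzero_dists V d)"
  proof (rule finite_subset)
    show "nonzero_dists V d \<subseteq> (\<lambda>(x, y). d x y) ` (V \<times> V)" by (auto simp: nonzero_dists_def)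
    show "finite ((\<lambda>(x, y). d x y) ` (V \<times> V))"
      using finite_metric_space by (simp add: finite_metric_space_def)
  qed
  have bounds: "1 \<le> e \<and> e \<le> real n ^ L" if e: "e \<in> nonzero_dists V d" for e
  proof -
    obtain f g where fg: "f \<in> B" "g \<in> B" "f \<noteq> g" "e = real_of_int (sup_dist I f g)"
      using e d_eq by (auto simp: nonzero_dists_def V_def)
    have "0 < sup_dist I f g"
      using sup_dist_nonneg[OF coords(1,3), of n L f g] sup_dist_eq_0_iff[OF coords(1,3) fg(1,2)] fg(3)
      by linarith
    moreover have "real_of_int (sup_dist I f g) \<le> real_of_int (int n ^ L)"
      using sup_dist_le_box[OF coords(1,3) fg(1,2)] by (rule of_int_le_iff[THEN iffD2])
    ultimately show ?thesis using fg(4) by simp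
  qed
  have "Max (nonzero_dists V d) = real n ^ L"
    by (rule Max_eqI[OF fin]) (use bounds ex[of "int n ^ L"] M in auto)
  moreover have "Min (nonzero_dists V d) = 1"
    by (rule Min_eqI[OF fin]) (use bounds ex[of 1] M in auto)
  ultimately show ?thesis by (simp add: aspect_ratio_def)
qed

text \<open>Each level replaces the pair by an edge of a gadget between its ends. The edge is
  \<open>n\<close> times shorter, and \<open>online_gadget_step\<close> raises the lower bound on
  its relative expected stretch by \<open>(r - 1) / 4\<close>. The coordinate conditions are what
  the locale \<open>gadget\<close> requires at the next level.\<close>

lemma adversary:
  assumes P: "prob_online_hst_embedding V d P" and "l \<le> L"
  shows "\<exists>xs u v. distinct xs \<and> set xs \<subseteq> B \<and> length xs = 2 + l * ((n - 1) * 2 ^ n) \<and>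
    u \<in> set xs \<and> v \<in> set xs \<and> (\<forall>p\<in>set xs. \<forall>z. l < fst z \<longrightarrow> p z = 0) \<and>
    (\<forall>z. v z - u z \<in> {0, int n ^ (L - l), - (int n ^ (L - l))}) \<and>
    v (0, {}) - u (0, {}) = int n ^ (L - l) \<and>
    ennreal (real n ^ (L - l) * (real l * (real r - 1) / 4)) \<le> expected_dist P (map h xs) (h u) (h v)"
  using \<open>l \<le> L\<close>
proof (induction l)
  case 0
  \<comment> \<open>The first pair spans the base axis; its stretch bound is 0.\<close>
  let ?u = "point 0" and ?v = "point (int n ^ L)"
  have M: "0 < int n ^ L" using one_le_diameter by linarith
  have "?u (0, {}) \<noteq> ?v (0, {})" unfolding point_def using M by (simp only: if_True simp_thms)
  then have ne: "?u \<noteq> ?v" by metis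
  have B: "?u \<in> B" "?v \<in> B" using point_in_B M by auto
  show ?case
    by (rule exI[of _ "[?u, ?v]"], rule exI[of _ ?u], rule exI[of _ ?v])
      (use ne B r in \<open>auto simp: point_def\<close>)
next
  case (Suc l)
  then obtain xs u v where dist: "distinct xs" and xsB: "set xs \<subseteq> B"
    and len: "length xs = 2 + l * ((n - 1) * 2 ^ n)"
    and uv: "u \<in> set xs" "v \<in> set xs" and zero: "\<And>p z. p \<in> set xs \<Longrightarrow> l < fst z \<Longrightarrow> p z = 0"
    and diff: "\<And>z. v z - u z \<in> {0, int n ^ (L - l), - (int n ^ (L - l))}"
    and base: "v (0, {}) - u (0, {}) = int n ^ (L - l)"
    and E: "ennreal (real n ^ (L - l) * (real l * (real r - 1) / 4))
      \<le> expected_dist P (map h xs) (h u) (h v)"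
    by (auto simp del: insert_iff)
  define w where "w = int n ^ (L - Suc l)"
  have "L - l = Suc (L - Suc l)" using Suc.prems by simp
  then have nw: "int n ^ (L - l) = int n * w" by (simp only: w_def power_Suc)
  have wM: "int n * w \<le> int n ^ L" unfolding nw[symmetric] using r by (intro power_increasing) auto
  have w: "0 < w" using r by (simp add: w_def)
  have uB: "u \<in> B" "v \<in> B" using uv xsB by auto
  interpret gadget n l L w "int n ^ L" u v
    by unfold_locales (use uB Suc.prems w r wM diff base nw zero uv in auto)
  \<comment> \<open>Only the inner layers contribute points, since layers 0 and \<open>n\<close>
    collapse to \<open>u\<close> and \<open>v\<close>.\<close>
  define G where "G = {1..<n} \<times> Pow {..<n}"
  obtain ys where ys: "set ys = \<gamma> ` G" "distinct ys"
    using finite_distinct_list[of "\<gamma> ` G"] by (auto simp: G_def)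
  have "card (\<gamma> ` G) = (n - 1) * 2 ^ n"
    using card_image[OF inj] by (simp add: G_def card_cartesian_product card_Pow)
  then have len_ys: "length ys = (n - 1) * 2 ^ n" using ys distinct_card by metis
  have ysB: "set ys \<subseteq> B" using ys in_box by (auto simp: G_def)
  have "set xs \<inter> set ys = {}"
  proof -
    have "\<gamma> p \<notin> set xs" if "p \<in> G" for p
    proof -
      obtain i x where "p = (i, x)" by (cases p)
      then show ?thesis using new[of i x] zero that by (auto simp: G_def)
    qed
    then show ?thesis using ys by auto
  qed
  define xs' where "xs' = xs @ ys"
  have dist': "distinct xs'" and xsB': "set xs' \<subseteq> B" and len': "length xs' = 2 + Suc l * ((n - 1) * 2 ^ n)"
    using dist ys \<open>_ = {}\<close> xsB ysB len len_ys by (simp_all add: xs'_def)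
  have in_xs': "\<gamma> (i, x) \<in> set xs'" if "i \<le> n" "x \<subseteq> {..<n}" for i x
  proof -
    have "i = 0 \<or> i = n \<or> (i, x) \<in> G" using that by (auto simp: G_def)
    then show ?thesis by (elim disjE) (use first last uv ys in \<open>auto simp: xs'_def\<close>)
  qed
  have "\<exists>i<n. \<exists>x j. x \<subseteq> {..<n} \<and> j < n \<and>
    ennreal (real n ^ (L - l) * (real l * (real r - 1) / 4) / real n + real_of_int w * (real r - 1) / 4)
      \<le> expected_dist P (map h xs') ((h \<circ> \<gamma>) (i, x)) ((h \<circ> \<gamma>) (Suc i, flip j x))"
  proof (rule online_gadget_step[where u = "h u" and v = "h v", OF P finite_metric_space r])
    show "0 < real_of_int w" using w by simp
    show "0 \<le> real n ^ (L - l) * (real l * (real r - 1) / 4)" using r by simp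
    show "distinct (map h xs')" using dist' inj_on_subset[OF h xsB'] by (simp add: distinct_map)
    show "set (map h xs') \<subseteq> V" using xsB' by (auto simp: V_def)
    show "(h \<circ> \<gamma>) ` ({..n} \<times> Pow {..<n}) \<subseteq> set (map h xs')" using in_xs' by auto
    show "(h \<circ> \<gamma>) (0, x) = h u \<and> (h \<circ> \<gamma>) (n, x) = h v" for x using first last by simp
    show "real_of_int w * real r \<le> d (h u) (h v)"
    proof -
      have "w * int r \<le> int n * w" using w by (simp add: mult.commute)
      also have "\<dots> \<le> sup_dist I u v"
        using sup_dist_ge[OF coords(1,2)[of n L], of u v] base nw by linarith
      finally have "real_of_int (w * int r) \<le> real_of_int (sup_dist I u v)" by (rule of_int_le_iff[THEN iffD2])
      then show ?thesis using d_eq[OF uB] by simp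
    qed
    \<comment> \<open>The online property: presenting the new points leaves the images of
      \<open>u\<close> and \<open>v\<close> fixed.\<close>
    show "ennreal (real n ^ (L - l) * (real l * (real r - 1) / 4)) \<le> expected_dist P (map h xs') (h u) (h v)"
      using E uv by (simp add: xs'_def expected_dist_append)
  next
    fix i j x y assume p: "(i, x) \<in> {..n} \<times> Pow {..<n}" and q: "(j, y) \<in> {..n} \<times> Pow {..<n}"
    have "real_of_int (w * int (min (ham n x y) (min j (n - j))))
        \<le> real_of_int (sup_dist I (\<gamma> (i, x)) (\<gamma> (j, y)))"
      by (rule of_int_le_iff[THEN iffD2], rule far) (use p in simp)
    then show "real_of_int w * real (min (ham n x y) (min j (n - j))) \<le> d ((h \<circ> \<gamma>) (i, x)) ((h \<circ> \<gamma>) (j, y))"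
      using d_eq[OF in_box in_box, of i j x y] p q by simp
  qed
  then obtain i x j where ixj: "i < n" "x \<subseteq> {..<n}" "j < n" and
    E': "ennreal (real n ^ (L - l) * (real l * (real r - 1) / 4) / real n + real_of_int w * (real r - 1) / 4)
      \<le> expected_dist P (map h xs') (h (\<gamma> (i, x))) (h (\<gamma> (Suc i, flip j x)))"
    by auto
  have "real n ^ (L - l) = real n * real_of_int w"
    using arg_cong[OF nw, of real_of_int] by simp
  \<comment> \<open>As the old pair has length \<open>n * w\<close>, its bound divided by
    \<open>n\<close> is \<open>w\<close> times the stretch accumulated so far.\<close>
  then have eq: "real n ^ (L - l) * (real l * (real r - 1) / 4) / real n + real_of_int w * (real r - 1) / 4
      = real_of_int w * (real (Suc l) * (real r - 1) / 4)"
    using r by (simp add: field_simps)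
  have wr: "real_of_int w = real n ^ (L - Suc l)" by (simp add: w_def)
  have E'': "ennreal (real n ^ (L - Suc l) * (real (Suc l) * (real r - 1) / 4))
      \<le> expected_dist P (map h xs') (h (\<gamma> (i, x))) (h (\<gamma> (Suc i, flip j x)))"
    using E' unfolding eq unfolding wr .
  have zero': "p z = 0" if "p \<in> set xs'" "Suc l < fst z" for p z
    using that zero[of p z] later[of z] ys(1) by (auto simp: xs'_def)
  have xsj: "\<gamma> (i, x) \<in> set xs'" "\<gamma> (Suc i, flip j x) \<in> set xs'"
    using ixj flip_subset[of x n j] by (auto intro!: in_xs')
  show ?case
    by (rule exI[of _ xs'], rule exI[of _ "\<gamma> (i, x)"], rule exI[of _ "\<gamma> (Suc i, flip j x)"],
        intro conjI ballI allI impI dist' xsB' len' xsj E'' zero')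
      (use step[OF ixj(1)] in \<open>simp_all add: w_def\<close>)
qed

text \<open>After all \<open>L\<close> levels the pair has distance \<open>n ^ 0 = 1\<close>, so its
  expected distance is its expected stretch.\<close>

lemma online_lower_bound:
  assumes P: "prob_online_hst_embedding V d P"
  shows "\<exists>\<sigma>. distinct \<sigma> \<and> set \<sigma> \<subseteq> V \<and> length \<sigma> = 2 + L * ((n - 1) * 2 ^ n) \<and>
    ennreal (real L * (real r - 1) / 4) \<le> expected_distortion P d \<sigma>"
proof -
  obtain xs u v where xs: "distinct xs" "set xs \<subseteq> B" "length xs = 2 + L * ((n - 1) * 2 ^ n)"
    and uv: "u \<in> set xs" "v \<in> set xs"
    and diff: "\<And>z. v z - u z \<in> {0, 1, - 1}" "v (0, {}) - u (0, {}) = 1"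
    and E: "ennreal (real L * (real r - 1) / 4) \<le> expected_dist P (map h xs) (h u) (h v)"
    using adversary[OF P order.refl] by (auto simp del: insert_iff)
  have B: "u \<in> B" "v \<in> B" using uv xs by auto
  have "u \<noteq> v" using diff(2) by auto
  then have ne: "h u \<noteq> h v" using inj_on_eq_iff[OF h B] by simp
  have "\<bar>u z - v z\<bar> \<le> 1" for z using diff(1)[of z] by auto
  then have "sup_dist I u v \<le> 1" using sup_dist_le_iff[OF coords(1,3)] by blast
  moreover have "1 \<le> sup_dist I u v" using sup_dist_ge[OF coords(1,2), of u v] diff(2) by (simp add: abs_if split: if_splits)
  ultimately have "d (h u) (h v) = 1" using d_eq[OF B] by simp
  moreover have dist: "distinct (map h xs)" using xs inj_on_subset[OF h] by (simp add: distinct_map)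
  ultimately have "ennreal (real L * (real r - 1) / 4) \<le> expected_distortion P d (map h xs)"
    using E expected_distortion_ge[OF dist, of "h u" "h v" P d] uv ne by (auto simp: divide_ennreal_def)
  moreover have "set (map h xs) \<subseteq> V" using xs by (auto simp: V_def)
  ultimately show ?thesis using dist xs(3) by (intro exI[of _ "map h xs"]) simp
qed

end

section \<open>Choice of parameters and conclusion\<close>

lemma hard_space_exists:
  assumes "0 < r" "0 < L"
  shows "\<exists>h. hard_space r L h"
proof -
  obtain h :: "(nat \<times> nat set \<Rightarrow> int) \<Rightarrow> nat" where "inj_on h (box (coords (4 * r) L) (int (4 * r) ^ L))"
    using finite_imp_inj_to_nat_seg[OF finite_box[OF coords(1)]] by blast
  then show ?thesis using assms by (auto simp: hard_space_def)
qed

text \<open>With \<open>L = 16 ^ (r * t)\<close>, \<open>k\<close> lies between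
  \<open>16 ^ (2 * r)\<close> and \<open>16 ^ (r * (t + 2))\<close>. So \<open>ln k\<close> is of
  order \<open>r\<close> for fixed \<open>t\<close>, and \<open>ln (ln k)\<close> cancels the factor
  \<open>ln (4 * r)\<close> of the logarithm of the aspect ratio.\<close>

lemma parameters:
  fixes \<delta> :: real and t r :: nat
  assumes \<delta>: "0 < \<delta>" "\<delta> < 1" and t: "2 / \<delta> \<le> real t" and r: "2 \<le> r"
  defines "L \<equiv> 16 ^ (r * t)"
  defines "k \<equiv> 2 + L * ((4 * r - 1) * 2 ^ (4 * r))"
  shows "2 powr (real k powr (1 - \<delta>)) \<le> real (4 * r) ^ L"
    and "1 / (32 * (real t + 2)) * ln (real k) * ln (real (4 * r) ^ L) / ln (ln (real k))
      \<le> real L * (real r - 1) / 4"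
proof -
  have "0 < 2 / \<delta>" using \<delta> by simp
  then have t1: "1 \<le> t" using t by (cases t) auto
  have p16: "(2::nat) ^ (4 * r) = 16 ^ r" by (simp add: power_mult)
  have r16: "4 * r \<le> 16 ^ r"
  proof (induction r)
    case (Suc r)
    have "4 * Suc r \<le> 16 * q" if "4 * r \<le> q" "1 \<le> q" for q :: nat using that by simp
    from this[OF Suc] show ?case by simp
  qed simp
  \<comment> \<open>Absorbs the two initial points: they count as at most one further layer in every
    level.\<close>
  have LX: "2 \<le> L * 16 ^ r"
  proof -
    have "(16::nat) ^ 1 \<le> 16 ^ r" using r by (intro power_increasing) auto
    moreover have "1 \<le> L" by (simp add: L_def)
    ultimately show ?thesis using mult_le_mono[of 1 L 16 "16 ^ r"] by simp
  qed
  have factor: "a * x + a * (m * x) = a * x * Suc m" for a x m :: nat by (simp add: algebra_simps)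
  have "k \<le> L * 16 ^ r + L * ((4 * r - 1) * 16 ^ r)"
    unfolding k_def p16 using LX by (rule add_right_mono)
  also have "\<dots> = L * 16 ^ r * (4 * r)" using factor[of L "16 ^ r" "4 * r - 1"] r by simp
  also have "\<dots> \<le> L * 16 ^ r * 16 ^ r" using r16 by (rule mult_le_mono2)
  also have "\<dots> = 16 ^ (r * t + r + r)" by (simp only: L_def power_add)
  also have "r * t + r + r = r * (t + 2)" by simp
  finally have "real k \<le> real (16 ^ (r * (t + 2)))" by (rule of_nat_mono)
  then have k_le: "real k \<le> 16 ^ (r * (t + 2))" by simp
  have k_ge: "16 ^ r * 16 ^ r \<le> k"
  proof -
    have "(16::nat) ^ r \<le> L" unfolding L_def using t1 by (intro power_increasing) auto
    then have "16 ^ r * 16 ^ r \<le> L * 16 ^ r * 1" by simp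
    also have "\<dots> \<le> L * 16 ^ r * (4 * r - 1)" using r by (intro mult_le_mono2) auto
    also have "\<dots> \<le> k" unfolding k_def p16 by (simp add: mult_ac)
    finally show ?thesis .
  qed
  have "0 < k" by (simp add: k_def)
  then have kpos: "0 < real k" by simp
  have "real k powr (1 - \<delta>) \<le> (16 ^ (r * (t + 2))) powr (1 - \<delta>)"
    using k_le \<delta> by (intro powr_mono2) auto
  also have "\<dots> = 16 powr (real r * ((real t + 2) * (1 - \<delta>)))"
    by (simp add: powr_powr flip: powr_realpow) (simp add: algebra_simps)
  also have "\<dots> \<le> 16 powr (real r * real t)"
  proof (intro powr_mono mult_left_mono)
    \<comment> \<open>The reason for \<open>t \<ge> 2 / \<delta>\<close>: it gives
      \<open>k powr (1 - \<delta>) \<le> L\<close>.\<close>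
    have "2 \<le> \<delta> * real t" using t \<delta> by (simp add: field_simps)
    then show "(real t + 2) * (1 - \<delta>) \<le> real t" using \<delta> by (simp add: algebra_simps)
  qed auto
  also have "\<dots> = real L" by (simp add: L_def flip: powr_realpow)
  finally have "2 powr (real k powr (1 - \<delta>)) \<le> 2 powr real L" by simp
  also have "\<dots> = 2 ^ L" by (simp add: powr_realpow)
  also have "\<dots> \<le> real (4 * r) ^ L" using r by (intro power_mono) auto
  finally show "2 powr (real k powr (1 - \<delta>)) \<le> real (4 * r) ^ L" .

  have "ln (real k) \<le> ln (16 ^ (r * (t + 2)))" using k_le kpos by simp
  also have "\<dots> = real (r * (t + 2)) * ln 16" by (simp add: ln_realpow)
  also have "ln (16::real) = 4 * ln 2" using ln_realpow[of 2 4] by simp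
  finally have lnk_le: "ln (real k) \<le> real r * (real t + 2) * 4"
    using ln_2_less_1 mult_left_mono[of "4 * ln 2" 4 "real r * (real t + 2)"] by (simp add: algebra_simps)
  \<comment> \<open>Rests on \<open>e^4 \<le> 81 \<le> 256\<close>.\<close>
  have "exp (real (4 * r)) = (exp 1 ^ 4) ^ r"
    by (simp flip: power_mult exp_of_nat_mult)
  also have "\<dots> \<le> (3 ^ 4) ^ r" by (intro power_mono exp_le) auto
  also have "\<dots> \<le> (16 * 16) ^ r" by (intro power_mono) auto
  also have "\<dots> = real (16 ^ r * 16 ^ r)" by (simp flip: power_mult_distrib)
  also have "\<dots> \<le> real k" using k_ge by (rule of_nat_mono)
  finally have lnk_ge: "real (4 * r) \<le> ln (real k)" using kpos by (simp add: ln_ge_iff)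
  then have lnln: "ln (real (4 * r)) \<le> ln (ln (real k))" using r by simp
  have ln4r: "0 < ln (real (4 * r))" using r by simp
  have "ln (real (4 * r) ^ L) = real L * ln (real (4 * r))" by (rule ln_realpow)
  then have "1 / (32 * (real t + 2)) * ln (real k) * ln (real (4 * r) ^ L) / ln (ln (real k))
     = (ln (real k) / (32 * (real t + 2)) * real L) * (ln (real (4 * r)) / ln (ln (real k)))"
    by simp
  also have "\<dots> \<le> (ln (real k) / (32 * (real t + 2)) * real L) * 1"
    using lnln ln4r lnk_ge by (intro mult_left_mono) (auto simp: divide_le_eq)
  \<comment> \<open>The constant 32 turns \<open>ln k \<le> 4 * r * (t + 2)\<close> into
    \<open>r / 8\<close>, which is at most \<open>(r - 1) / 4\<close> for
    \<open>r \<ge> 2\<close>.\<close>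
  also have "\<dots> \<le> (real r / 8) * real L"
    unfolding mult_1_right by (rule mult_right_mono) (use lnk_le in \<open>auto simp: field_simps\<close>)
  also have "\<dots> \<le> real L * (real r - 1) / 4"
    using r mult_left_mono[of "real r / 8" "(real r - 1) / 4" "real L"] by simp
  finally show "1 / (32 * (real t + 2)) * ln (real k) * ln (real (4 * r) ^ L) / ln (ln (real k))
      \<le> real L * (real r - 1) / 4" .
qed

theorem theorem1p5:
  shows "\<forall>\<delta>::real. 0 < \<delta> \<and> \<delta> < 1 \<longrightarrow>
    (\<exists>c::real. c > 0 \<and>
      (\<exists>(V :: nat \<Rightarrow> nat set) (d :: nat \<Rightarrow> nat \<Rightarrow> nat \<Rightarrow> real) (k :: nat \<Rightarrow> nat).
         strict_mono k \<and>
         (\<forall>l. finite_metric_space (V l) (d l) \<and>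
              2 powr (real (k l) powr (1 - \<delta>)) \<le> aspect_ratio (V l) (d l) \<and>
              (\<forall>P. prob_online_hst_embedding (V l) (d l) P \<longrightarrow>
                 (\<exists>\<sigma>. distinct \<sigma> \<and> set \<sigma> \<subseteq> V l \<and> length \<sigma> = k l \<and>
                    ennreal (c * ln (real (k l)) * ln (aspect_ratio (V l) (d l))
                              / ln (ln (real (k l))))
                      \<le> expected_distortion P (d l) \<sigma>)))))"
proof (intro allI impI)
  fix \<delta> :: real assume "0 < \<delta> \<and> \<delta> < 1"
  then have \<delta>: "0 < \<delta>" "\<delta> < 1" by auto
  obtain t :: nat where t: "2 / \<delta> \<le> real t" using real_arch_simple by blast
  \<comment> \<open>The shift by 2 secures \<open>r \<ge> 2\<close>; growth in \<open>l\<close>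
    makes \<open>k\<close> strictly increasing.\<close>
  define r where "r l = l + 2" for l :: nat
  define L where "L l = (16::nat) ^ (r l * t)" for l
  define k where "k l = 2 + L l * ((4 * r l - 1) * 2 ^ (4 * r l))" for l
  have "\<exists>h. hard_space (r l) (L l) h" for l by (rule hard_space_exists) (auto simp: r_def L_def)
  then obtain h where h: "\<And>l. hard_space (r l) (L l) (h l)" by metis
  define V where "V l = hard_space.V (r l) (L l) (h l)" for l
  define d where "d l = hard_space.d (r l) (L l) (h l)" for l
  note par = parameters[OF \<delta> t, of "r l" for l, folded L_def, folded k_def]
  have r2: "2 \<le> r l" for l by (simp add: r_def)
  show "\<exists>c::real. c > 0 \<and>
      (\<exists>(V :: nat \<Rightarrow> nat set) (d :: nat \<Rightarrow> nat \<Rightarrow> nat \<Rightarrow> real) (k :: nat \<Rightarrow> nat).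
         strict_mono k \<and>
         (\<forall>l. finite_metric_space (V l) (d l) \<and>
              2 powr (real (k l) powr (1 - \<delta>)) \<le> aspect_ratio (V l) (d l) \<and>
              (\<forall>P. prob_online_hst_embedding (V l) (d l) P \<longrightarrow>
                 (\<exists>\<sigma>. distinct \<sigma> \<and> set \<sigma> \<subseteq> V l \<and> length \<sigma> = k l \<and>
                    ennreal (c * ln (real (k l)) * ln (aspect_ratio (V l) (d l))
                              / ln (ln (real (k l))))
                      \<le> expected_distortion P (d l) \<sigma>))))"
  \<comment> \<open>The constant depends on \<open>\<delta>\<close> only, through
    \<open>t\<close>.\<close>
  proof (rule exI[of _ "1 / (32 * (real t + 2))"], intro conjI exI[of _ V] exI[of _ d] exI[of _ k] allI impI)
    show "0 < 1 / (32 * (real t + 2))" by simp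
    show "strict_mono k"
    proof (rule strict_mono_Suc_iff[THEN iffD2], rule allI)
      fix l
      have "L l \<le> L (Suc l)" unfolding L_def r_def by (intro power_increasing mult_le_mono) auto
      moreover have "(4 * r l - 1) * 2 ^ (4 * r l) < (4 * r (Suc l) - 1) * 2 ^ (4 * r (Suc l))"
        unfolding r_def by (rule mult_strict_mono) auto
      moreover have "0 < L l" by (simp add: L_def)
      ultimately show "k l < k (Suc l)" unfolding k_def
        by (intro add_strict_left_mono mult_le_less_imp_less[where c = "_ * _"]) simp_all
    qed
    fix l
    show "finite_metric_space (V l) (d l)"
      unfolding V_def d_def by (rule hard_space.finite_metric_space[OF h])
    have asp: "aspect_ratio (V l) (d l) = real (4 * r l) ^ L l"
      unfolding V_def d_def by (rule hard_space.aspect_ratio[OF h])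
    show "2 powr (real (k l) powr (1 - \<delta>)) \<le> aspect_ratio (V l) (d l)"
      unfolding asp by (rule par(1)[OF r2])
    fix P assume "prob_online_hst_embedding (V l) (d l) P"
    then obtain \<sigma> where \<sigma>: "distinct \<sigma>" "set \<sigma> \<subseteq> V l" "length \<sigma> = k l"
      "ennreal (real (L l) * (real (r l) - 1) / 4) \<le> expected_distortion P (d l) \<sigma>"
      unfolding V_def d_def k_def using hard_space.online_lower_bound[OF h] by blast
    moreover have "ennreal (1 / (32 * (real t + 2)) * ln (real (k l)) * ln (aspect_ratio (V l) (d l))
        / ln (ln (real (k l)))) \<le> ennreal (real (L l) * (real (r l) - 1) / 4)"
      unfolding asp by (rule ennreal_leI, rule par(2)[OF r2])
    ultimately show "\<exists>\<sigma>. distinct \<sigma> \<and> set \<sigma> \<subseteq> V l \<and> length \<sigma> = k l \<and>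
        ennreal (1 / (32 * (real t + 2)) * ln (real (k l)) * ln (aspect_ratio (V l) (d l))
        / ln (ln (real (k l)))) \<le> expected_distortion P (d l) \<sigma>"
      by (meson order.trans)
  qed
qed

end
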